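(* 1) Let $G$ be a directed graph with vertex set $V$ and edge set $E$, possibly with multiple edges and loops. For each edge $e\in E$ let an $N\times N$ matrix $T_e=(t^{(e)}_{ij})_{i,j=1}^N$ be given. Let $$S_G(N):=\sum_{i:V\to[N]}\ \prod_{e\in E} t^{(e)}_{i_{t(e)},\,i_{s(e)}},$$ where the sum runs over all functions $i:V\to[N]=\{1,\dots,N\}$. Then $$|S_G(N)|\le N^{\mathfrak r(G)}\cdot\prod_{e\in E}\|T_e\|,$$ where $\mathfrak r(G)$ is determined by the forest $\mathfrak F(G)$ of two-edge connected components of $G$ as $$\mathfrak r(G)=\sum_{\mathfrak l\text{ leaf of }\mathfrak F(G)}\mathfrak r(\mathfrak l),\qquad \mathfrak r(\mathfrak l):=\begin{cases}1,&\text{if }\mathfrak l\text{ is a trivial leaf},\\ \tfrac12,&\text{if }\mathfrak l\text{ is a leaf of a non-trivial tree}.\end{cases}$$ 2) This bound is optimal in the following sense: for each such graph $G$ and each $N\in\mathbb N$ (with $N\ge 1$) there exist $N\times N$ matrices $T_e$ with $\|T_e\|=1$ for all $e\in E$ such that $S_G(N)=N^{\mathfrak r(G)}$.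
   Context: Graphs are finite. Matrices have complex entries and $\|T\|$ is the operator norm (with respect to the Euclidean norm). For an edge $e$, $s(e)$ and $t(e)$ denote its source and target vertex; $i_v$ denotes $i(v)$. The following notions ignore edge orientations. A cutting edge of a connected graph is an edge whose removal would result in two disconnected subgraphs (for a general graph, a cutting edge is a cutting edge of one of its connected components). A connected graph is two-edge connected if it does not contain a cutting edge (in particular, a single vertex is two-edge connected). A two-edge connected component of a graph is a subgraph which is two-edge connected and cannot be enlarged to a bigger two-edge connected subgraph. The forest of two-edge connected components $\mathfrak F(G)$ is the graph whose vertices are the two-edge connected components of $G$, two distinct vertices being connected by an edge if there is a cutting edge of $G$ between vertices from the two corresponding components; it has no cycles. A forest is a graph without cycles; a tree is a connected component of a forest. A tree is trivial if it consists of only one vertex. A leaf of a non-trivial tree is a vertex which meets only one edge. The sole vertex of a trivial tree is also a leaf, called a trivial leaf. *)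

theory Defs
  imports "HOL-Analysis.Analysis" "Graph_Theory.Graph_Theory"
begin

text \<open>
  Finite directed multigraphs with loops are \<^locale>\<open>fin_digraph\<close>s.
  \<^const>\<open>Digraph_Component.connected\<close> (qualified because of the topological notion of the
  same name) ignores orientations and does not hold for the empty graph.
\<close>

definition connected_component_of_graph ::
    "('a, 'b) pre_digraph \<Rightarrow> ('a, 'b) pre_digraph \<Rightarrow> bool" where
  "connected_component_of_graph G H \<longleftrightarrow>
     pre_digraph.max_subgraph G Digraph_Component.connected H"

text \<open>For connected \<open>H\<close>; arbitrary graphs are reduced to this case componentwise below.\<close>

definition cutting_edge_connected :: "('a, 'b) pre_digraph \<Rightarrow> 'b \<Rightarrow> bool" where
  "cutting_edge_connected H e \<longleftrightarrow>
     e \<in> arcs H \<and> \<not> Digraph_Component.connected (pre_digraph.del_arc H e)"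

definition cutting_edge :: "('a, 'b) pre_digraph \<Rightarrow> 'b \<Rightarrow> bool" where
  "cutting_edge G e \<longleftrightarrow>
     (\<exists>H. connected_component_of_graph G H \<and> cutting_edge_connected H e)"

definition two_edge_connected :: "('a, 'b) pre_digraph \<Rightarrow> bool" where
  "two_edge_connected H \<longleftrightarrow>
     Digraph_Component.connected H \<and> \<not> (\<exists>e. cutting_edge_connected H e)"

definition two_edge_component :: "('a, 'b) pre_digraph \<Rightarrow> ('a, 'b) pre_digraph \<Rightarrow> bool" where
  "two_edge_component G C \<longleftrightarrow> pre_digraph.max_subgraph G two_edge_connected C"

text \<open>
  The forest of two-edge connected components is an undirected simple graph. It is encoded as a
  symmetric digraph: an undirected edge between \<open>C\<close> and \<open>D\<close> is the pair of arcs
  \<open>(C, D)\<close>, \<open>(D, C)\<close>. Hence the number of edges meeting a vertex is its out-degree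
  (there are no loops).
\<close>

definition component_forest ::
    "('a, 'b) pre_digraph \<Rightarrow> ('a, 'b) pre_digraph pair_pre_digraph" where
  "component_forest G =
     \<lparr> pverts = {C. two_edge_component G C},
       parcs = {(C, D). two_edge_component G C \<and> two_edge_component G D \<and> C \<noteq> D \<and>
                 (\<exists>e. cutting_edge G e \<and>
                   (tail G e \<in> verts C \<and> head G e \<in> verts D \<or>
                    tail G e \<in> verts D \<and> head G e \<in> verts C))} \<rparr>"

text \<open>In the next two definitions \<open>F\<close> is a forest in this encoding; its trees are its connected
  components.\<close>

definition trivial_leaf :: "('c, 'd) pre_digraph \<Rightarrow> 'c \<Rightarrow> bool" where
  "trivial_leaf F l \<longleftrightarrow> (\<exists>T. connected_component_of_graph F T \<and> verts T = {l})"

definition nontrivial_leaf :: "('c, 'd) pre_digraph \<Rightarrow> 'c \<Rightarrow> bool" where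
  "nontrivial_leaf F l \<longleftrightarrow>
     (\<exists>T. connected_component_of_graph F T \<and> l \<in> verts T \<and> verts T \<noteq> {l} \<and> out_degree T l = 1)"

definition leaf_weight :: "('c, 'd) pre_digraph \<Rightarrow> 'c \<Rightarrow> real" where
  "leaf_weight F l = (if trivial_leaf F l then 1 else 1 / 2)"

definition graph_exponent :: "('a, 'b) pre_digraph \<Rightarrow> real" where
  "graph_exponent G =
     (let F = with_proj (component_forest G)
      in \<Sum>l | trivial_leaf F l \<or> nontrivial_leaf F l. leaf_weight F l)"

text \<open>
  The index set \<open>{1, \<dots>, N}\<close> is a finite type \<open>'n\<close> with \<open>CARD('n) = N\<close>, and index
  functions are extensional functions on the vertex set. In \<open>A $ i $ j\<close> the row index is
  \<open>i\<close>.
\<close>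

definition graph_sum :: "('a, 'b) pre_digraph \<Rightarrow> ('b \<Rightarrow> complex^'n^'n) \<Rightarrow> complex" where
  "graph_sum G T =
     (\<Sum>i \<in> verts G \<rightarrow>\<^sub>E (UNIV :: 'n set). \<Prod>e \<in> arcs G. T e $ i (head G e) $ i (tail G e))"

definition op_norm :: "complex^'n^'m \<Rightarrow> real" where
  "op_norm A = onorm (\<lambda>x. A *v x)"

end

theory Submission
  imports Defs
begin

text \<open>
  Write \<open>N\<close> for the dimension. For a connected set \<open>B\<close> of vertices consider the part of the graph sum in
  which the indices on \<open>B\<close> are summed, all edges with an end in \<open>B\<close> contribute, and the indices at the
  adjacent vertices outside \<open>B\<close> stay free (\<open>pinned_sum\<close>). It is a tensor with one index for every adjacent
  vertex. Calling some of these vertices consumed, some produced, and pinning the others turns it into an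
  operator, and the upper bound follows from estimates of the norms of such operators.

  The main estimate is \<open>leaf_transfer_holds\<close>. If one edge of the boundary of \<open>B\<close> serves as a way in and a
  different one as a way out, then the norm is at most the product of the norms of the matrices on the
  edges, with an additional factor \<open>\<surd>N\<close> for every leaf of the forest of two-edge connected components that
  lies inside \<open>B\<close>. The proof is an induction that removes the inner end \<open>v\<close> of the way in. The index at
  \<open>v\<close> is created by the matrix on the way in; the other edges at \<open>v\<close> and the connected pieces of \<open>B - {v}\<close>
  then act one after the other. A piece with at least two boundary edges satisfies the induction
  hypothesis with \<open>v\<close> pinned, for any roles of its other adjacent vertices, so that it acts without loss
  while the index at \<open>v\<close> is kept; the part that contains the way out acts last and consumes \<open>v\<close>. A piece
  with only one boundary edge contains a leaf (\<open>leaf_bridge_class_within\<close>), and a leaf can replace the way out,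
  because summing over an index freely costs \<open>\<surd>N\<close>. A connected component of the graph without bridges
  then costs \<open>\<surd>N\<close> twice, for the creation and for the absorption of its first index, while a component
  with bridges contains at least two leaves, which pay for both (\<open>component_bound\<close>, \<open>component_bound_leaves\<close>).

  For optimality, identity matrices on the edges that are not bridges force the index to be constant on
  every two-edge connected component. On a bridge take the rank one matrix formed from unit vectors
  attached to the components at its ends. The sum becomes a product over the components \<open>Q\<close> of
  \<open>\<Sum>\<^sub>k u k ^ d\<close>, where \<open>u\<close> is the vector of \<open>Q\<close> and \<open>d\<close> the number of bridges at \<open>Q\<close>. The normalized
  vector of ones for \<open>d = 1\<close> and a basis vector for \<open>d \<ge> 2\<close> give \<open>\<surd>N\<close> and \<open>1\<close>, and \<open>d = 0\<close> gives \<open>N\<close>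
  (\<open>extremal_sum\<close>).

  The graph theory is carried out with cuts instead of paths: a bridge is an edge that forms the whole
  boundary of some vertex set, and the two-edge connected components are the subgraphs induced on the
  atoms of the Boolean algebra of vertex sets bounded by bridges only (\<open>two_edge_component_iff\<close>). Trivial
  leaves are the atoms with empty boundary, and leaves of non-trivial trees those with exactly one
  boundary edge (\<open>graph_exponent_eq\<close>).
\<close>

section \<open>Summing out variables of a function of an assignment\<close>

definition indep :: "'a set \<Rightarrow> (('a \<Rightarrow> 'n) \<Rightarrow> 'c) \<Rightarrow> bool" where
  "indep Z f \<longleftrightarrow> (\<forall>i j. (\<forall>w. w \<notin> Z \<longrightarrow> i w = j w) \<longrightarrow> f i = f j)"

text \<open>
  The remaining coordinates of the assignment \<open>i\<close> act as parameters. Because assignments are total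
  functions, a kernel, the states it acts on and the results all have the same type, and tensor
  products and partial contractions of tensors need no change of index set.
\<close>

definition sum_out :: "'a set \<Rightarrow> (('a \<Rightarrow> 'n::finite) \<Rightarrow> 'c::comm_monoid_add) \<Rightarrow> ('a \<Rightarrow> 'n) \<Rightarrow> 'c" where
  "sum_out X f i = (\<Sum>a \<in> X \<rightarrow>\<^sub>E UNIV. f (override_on i a X))"

lemma indepD: "indep Z f \<Longrightarrow> (\<And>w. w \<notin> Z \<Longrightarrow> i w = j w) \<Longrightarrow> f i = f j"
  unfolding indep_def by blast

lemma indepI: "(\<And>i j. (\<And>w. w \<notin> Z \<Longrightarrow> i w = j w) \<Longrightarrow> f i = f j) \<Longrightarrow> indep Z f"
  unfolding indep_def by blast

lemma indep_subset: "indep Z f \<Longrightarrow> Z' \<subseteq> Z \<Longrightarrow> indep Z' f"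
  unfolding indep_def by (metis subsetD)

lemma indep_const: "indep Z (\<lambda>i. c)"
  by (simp add: indep_def)

lemma indep_comp2: "indep Z f \<Longrightarrow> indep Z g \<Longrightarrow> indep Z (\<lambda>i. h (f i) (g i))"
  unfolding indep_def by metis

lemma indep_prod:
  assumes "\<And>e. e \<in> E \<Longrightarrow> indep Z (f e)"
  shows "indep Z (\<lambda>i. \<Prod>e\<in>E. f e i)"
  by (rule indepI, rule prod.cong[OF refl]) (auto intro: indepD[OF assms])

lemma sum_out_empty [simp]: "sum_out {} f i = f i"
  by (simp add: sum_out_def)

lemma sum_out_insert:
  fixes f :: "('a \<Rightarrow> 'n::finite) \<Rightarrow> 'c::comm_monoid_add"
  assumes "finite X" "v \<notin> X"
  shows "sum_out (insert v X) f i = (\<Sum>k\<in>UNIV. sum_out X f (i(v := k)))"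
proof -
  let ?h = "\<lambda>(y, g). g(v := y)"
  \<comment> \<open>Split an assignment on \<open>insert v X\<close> into its value at \<open>v\<close> and the rest.\<close>
  have eq: "insert v X \<rightarrow>\<^sub>E (UNIV :: 'n set) = ?h ` (UNIV \<times> (X \<rightarrow>\<^sub>E UNIV))"
    by (rule PiE_insert_eq)
  have inj: "inj_on ?h (UNIV \<times> (X \<rightarrow>\<^sub>E (UNIV :: 'n set)))"
    using assms(2) by (rule inj_combinator)
  have ov: "override_on i (g(v := y)) (insert v X) = override_on (i(v := y)) g X" for y g
    using assms(2) by (auto simp: override_on_def fun_eq_iff)
  have "sum_out (insert v X) f i = (\<Sum>(y, g)\<in>UNIV \<times> (X \<rightarrow>\<^sub>E UNIV). f (override_on (i(v := y)) g X))"
    unfolding sum_out_def eq sum.reindex[OF inj] by (rule sum.cong) (auto simp: ov)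
  then show ?thesis by (simp add: sum_out_def sum.cartesian_product)
qed

lemma sum_out_cong:
  assumes "\<And>j. (\<And>w. w \<notin> X \<Longrightarrow> j w = i w) \<Longrightarrow> f j = g j"
  shows "sum_out X f i = sum_out X g i"
  unfolding sum_out_def by (rule sum.cong[OF refl], rule assms) (auto simp: override_on_def)

lemma sum_out_Un:
  assumes "finite X" "finite Y" "X \<inter> Y = {}"
  shows "sum_out (X \<union> Y) f i = sum_out X (sum_out Y f) i"
  using assms
proof (induction X arbitrary: i rule: finite_induct)
  case (insert v X)
  have "sum_out (insert v X \<union> Y) f i = sum_out (insert v (X \<union> Y)) f i" by simp
  also have "\<dots> = (\<Sum>k\<in>UNIV. sum_out (X \<union> Y) f (i(v := k)))"
    using insert by (intro sum_out_insert) auto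
  also have "\<dots> = sum_out (insert v X) (sum_out Y f) i"
    using insert by (subst sum_out_insert) auto
  finally show ?case .
qed simp

lemma sum_out_singleton: "sum_out {v} f i = (\<Sum>k\<in>UNIV. f (i(v := k)))"
  using sum_out_insert[of "{}" v f i] by simp

lemma sum_out_cmult:
  fixes f :: "('a \<Rightarrow> 'n::finite) \<Rightarrow> 'c::comm_semiring_0"
  assumes "indep X g"
  shows "sum_out X (\<lambda>j. g j * f j) i = g i * sum_out X f i"
proof -
  have "g (override_on i a X) = g i" for a
    by (rule indepD[OF assms]) (auto simp: override_on_def)
  then show ?thesis by (simp add: sum_out_def sum_distrib_left)
qed

lemma sum_out_multc:
  fixes f :: "('a \<Rightarrow> 'n::finite) \<Rightarrow> 'c::comm_semiring_0"
  assumes "indep X g"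
  shows "sum_out X (\<lambda>j. f j * g j) i = sum_out X f i * g i"
  using sum_out_cmult[OF assms, of f i] by (simp add: mult.commute)

lemma indep_sum_out_self: "indep X (sum_out X f)"
proof (rule indepI)
  fix i j :: "'a \<Rightarrow> 'b" assume a: "\<And>w. w \<notin> X \<Longrightarrow> i w = j w"
  have "override_on i a X = override_on j a X" for a
    using a by (auto simp: override_on_def)
  then show "sum_out X f i = sum_out X f j" by (simp add: sum_out_def)
qed

lemma indep_sum_out:
  assumes "indep Z f"
  shows "indep Z (sum_out X f)"
proof (rule indepI)
  fix i j :: "'a \<Rightarrow> 'b" assume a: "\<And>w. w \<notin> Z \<Longrightarrow> i w = j w"
  have "f (override_on i a X) = f (override_on j a X)" for a
    by (rule indepD[OF assms]) (auto simp: override_on_def a)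
  then show "sum_out X f i = sum_out X f j" by (simp add: sum_out_def)
qed

lemma indep_Un:
  assumes "indep Y f" "indep Z f"
  shows "indep (Y \<union> Z) f"
proof (rule indepI)
  fix i j :: "'a \<Rightarrow> 'b" assume a: "\<And>w. w \<notin> Y \<union> Z \<Longrightarrow> i w = j w"
  have "f i = f (override_on i j Y)"
    by (rule indepD[OF assms(1)]) (auto simp: override_on_def)
  also have "\<dots> = f j"
    by (rule indepD[OF assms(2)]) (use a in \<open>auto simp: override_on_def\<close>)
  finally show "f i = f j" .
qed

lemma sum_out_mono:
  fixes f g :: "('a \<Rightarrow> 'n::finite) \<Rightarrow> real"
  assumes "\<And>j. f j \<le> g j"
  shows "sum_out X f i \<le> sum_out X g i"
  unfolding sum_out_def by (intro sum_mono assms)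

lemma sum_out_nonneg:
  fixes f :: "('a \<Rightarrow> 'n::finite) \<Rightarrow> real"
  assumes "\<And>j. 0 \<le> f j"
  shows "0 \<le> sum_out X f i"
  unfolding sum_out_def by (intro sum_nonneg assms)

lemma sum_out_const_mult:
  fixes f :: "('a \<Rightarrow> 'n::finite) \<Rightarrow> 'c::comm_semiring_0"
  shows "sum_out X (\<lambda>j. c * f j) i = c * sum_out X f i"
  by (simp add: sum_out_def sum_distrib_left)

section \<open>Operator norm bounds for kernels\<close>

text \<open>
  \<open>transfer_bound A B K c\<close>: the kernel \<open>K\<close>, read as an operator from functions of the variables \<open>A\<close> to functions
  of the variables \<open>B\<close>, has norm at most \<open>c\<close>. All other variables are parameters: if \<open>K\<close> depends on them
  they are pinned, if only the state \<open>\<phi>\<close> does they are an idle tensor factor. Both amplification by an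
  identity operator and pinning of variables are therefore built in.
\<close>

definition transfer_bound ::
    "'a set \<Rightarrow> 'a set \<Rightarrow> (('a \<Rightarrow> 'n::finite) \<Rightarrow> complex) \<Rightarrow> real \<Rightarrow> bool" where
  "transfer_bound A B K c \<longleftrightarrow>
     (\<forall>\<phi> i. indep B \<phi> \<longrightarrow>
        sum_out B (\<lambda>j. (norm (sum_out A (\<lambda>l. K l * \<phi> l) j))\<^sup>2) i
          \<le> c\<^sup>2 * sum_out A (\<lambda>j. (norm (\<phi> j))\<^sup>2) i)"

lemma transfer_boundD:
  "transfer_bound A B K c \<Longrightarrow> indep B \<phi> \<Longrightarrow>
        sum_out B (\<lambda>j. (norm (sum_out A (\<lambda>l. K l * \<phi> l) j))\<^sup>2) i
          \<le> c\<^sup>2 * sum_out A (\<lambda>j. (norm (\<phi> j))\<^sup>2) i"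
  by (auto simp: transfer_bound_def)

lemma transfer_bound_mono:
  assumes "transfer_bound A B K c" "0 \<le> c" "c \<le> d"
  shows "transfer_bound A B K d"
  unfolding transfer_bound_def
proof (intro allI impI)
  fix \<phi> :: "('a \<Rightarrow> 'b) \<Rightarrow> complex" and i assume "indep B \<phi>"
  from transfer_boundD[OF assms(1) this, of i]
  show "sum_out B (\<lambda>j. (norm (sum_out A (\<lambda>l. K l * \<phi> l) j))\<^sup>2) i
          \<le> d\<^sup>2 * sum_out A (\<lambda>j. (norm (\<phi> j))\<^sup>2) i"
    by (rule order_trans) (intro mult_right_mono power_mono assms sum_out_nonneg, auto)
qed

text \<open>
  Submultiplicativity of the operator norm. The variables in \<open>B1 \<inter> A2\<close> are produced by \<open>K\<close> and consumed
  by \<open>L\<close>, so they are summed. Variables that only one of the two operators consumes or produces pass the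
  other one as an idle tensor factor. No variable may be consumed and produced again, since one name
  would then stand for two different indices.
\<close>

lemma transfer_bound_comp:
  fixes K L :: "('a \<Rightarrow> 'n::finite) \<Rightarrow> complex"
  assumes fin: "finite A1" "finite B1" "finite A2" "finite B2"
    and disj: "A1 \<inter> B1 = {}" "A2 \<inter> B2 = {}" "A1 \<inter> A2 = {}" "A1 \<inter> B2 = {}" "B1 \<inter> B2 = {}"
    and K: "transfer_bound A1 B1 K c" "indep B2 K"
    and L: "transfer_bound A2 B2 L d" "indep A1 L"
  shows "transfer_bound (A1 \<union> (A2 - B1)) (B2 \<union> (B1 - A2)) (sum_out (B1 \<inter> A2) (\<lambda>i. K i * L i)) (c * d)"
  unfolding transfer_bound_def
proof (intro allI impI)
  define W A B where "W = B1 \<inter> A2" and "A = A1 \<union> (A2 - B1)" and "B = B2 \<union> (B1 - A2)"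
  fix \<phi>0 :: "('a \<Rightarrow> 'n) \<Rightarrow> complex" and i
  assume "indep (B2 \<union> (B1 - A2)) \<phi>0"
  then have \<phi>0: "indep B \<phi>0" by (simp add: B_def)
  have fins: "finite W" "finite A" "finite B" using fin by (auto simp: W_def A_def B_def)
  \<comment> \<open>The variables in \<open>W\<close> are summed inside the composed kernel, so \<open>\<phi>0\<close> is read only where they
    have the value given by \<open>i\<close>; freezing them there makes \<open>\<phi>\<close> independent of \<open>W\<close> as well.\<close>
  define \<phi> where "\<phi> = (\<lambda>j. \<phi>0 (override_on j i W))"
  have \<phi>W: "indep W \<phi>"
    unfolding \<phi>_def by (rule indepI, rule arg_cong[where f=\<phi>0]) (auto simp: override_on_def)
  have \<phi>B: "indep B \<phi>"
    unfolding \<phi>_def by (rule indepI, rule indepD[OF \<phi>0]) (auto simp: override_on_def)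
  have \<phi>eq: "\<phi>0 j = \<phi> j" if "\<And>w. w \<in> W \<Longrightarrow> j w = i w" for j
    unfolding \<phi>_def by (rule arg_cong[where f=\<phi>0]) (use that in \<open>auto simp: override_on_def\<close>)
  have dAW: "A \<inter> W = {}" "B \<inter> W = {}" "A \<inter> B = {}" using disj by (auto simp: W_def A_def B_def)
  define \<psi> where "\<psi> = sum_out A1 (\<lambda>l. K l * \<phi> l)"
  have contract: "sum_out A (\<lambda>l. sum_out W (\<lambda>i. K i * L i) l * \<phi> l) j
      = sum_out A2 (\<lambda>l. L l * \<psi> l) j" for j
  proof -
    have "sum_out A (\<lambda>l. sum_out W (\<lambda>i. K i * L i) l * \<phi> l) j
        = sum_out A (sum_out W (\<lambda>l. K l * L l * \<phi> l)) j"
      by (rule arg_cong[where f="\<lambda>f. sum_out A f j"]) (auto simp: sum_out_multc[OF \<phi>W])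
    also have "\<dots> = sum_out (A \<union> W) (\<lambda>l. K l * L l * \<phi> l) j"
      using fins dAW by (subst sum_out_Un) auto
    also have "A \<union> W = A2 \<union> A1" by (auto simp: A_def W_def)
    also have "sum_out (A2 \<union> A1) (\<lambda>l. K l * L l * \<phi> l) j
        = sum_out A2 (sum_out A1 (\<lambda>l. L l * (K l * \<phi> l))) j"
      using fin disj by (subst sum_out_Un) (auto simp: ac_simps)
    also have "\<dots> = sum_out A2 (\<lambda>l. L l * \<psi> l) j"
      unfolding \<psi>_def
      by (rule arg_cong[where f="\<lambda>f. sum_out A2 f j"]) (auto simp: sum_out_cmult[OF L(2)])
    finally show ?thesis .
  qed
  have \<psi>B2: "indep B2 \<psi>"
    unfolding \<psi>_def
    by (intro indep_sum_out indep_comp2[of _ _ _ "(*)"] K(2) indep_subset[OF \<phi>B]) (auto simp: B_def)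
  have \<phi>B1: "indep B1 \<phi>"
    by (rule indep_subset[OF indep_Un[OF \<phi>B \<phi>W]]) (auto simp: B_def W_def)
  have "sum_out B (\<lambda>j. (norm (sum_out A (\<lambda>l. sum_out W (\<lambda>i. K i * L i) l * \<phi>0 l) j))\<^sup>2) i
      = sum_out B (\<lambda>j. (norm (sum_out A (\<lambda>l. sum_out W (\<lambda>i. K i * L i) l * \<phi> l) j))\<^sup>2) i"
  proof (rule sum_out_cong)
    fix j assume j: "\<And>w. w \<notin> B \<Longrightarrow> j w = i w"
    have "sum_out A (\<lambda>l. sum_out W (\<lambda>i. K i * L i) l * \<phi>0 l) j
        = sum_out A (\<lambda>l. sum_out W (\<lambda>i. K i * L i) l * \<phi> l) j"
    proof (rule sum_out_cong)
      fix l assume l: "\<And>w. w \<notin> A \<Longrightarrow> l w = j w"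
      have "\<phi>0 l = \<phi> l"
      proof (rule \<phi>eq)
        fix w assume "w \<in> W"
        then have "w \<notin> A" "w \<notin> B" using dAW by auto
        then show "l w = i w" using l j by simp
      qed
      then show "sum_out W (\<lambda>i. K i * L i) l * \<phi>0 l = sum_out W (\<lambda>i. K i * L i) l * \<phi> l" by simp
    qed
    then show "(norm (sum_out A (\<lambda>l. sum_out W (\<lambda>i. K i * L i) l * \<phi>0 l) j))\<^sup>2
      = (norm (sum_out A (\<lambda>l. sum_out W (\<lambda>i. K i * L i) l * \<phi> l) j))\<^sup>2" by simp
  qed
  also have "\<dots> = sum_out B (\<lambda>j. (norm (sum_out A2 (\<lambda>l. L l * \<psi> l) j))\<^sup>2) i"
    by (simp only: contract)
  also have "\<dots> = sum_out (B1 - A2) (sum_out B2 (\<lambda>j. (norm (sum_out A2 (\<lambda>l. L l * \<psi> l) j))\<^sup>2)) i"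
    unfolding B_def using fin disj by (subst Un_commute, subst sum_out_Un) auto
  also have "\<dots> \<le> sum_out (B1 - A2) (\<lambda>j. d\<^sup>2 * sum_out A2 (\<lambda>j. (norm (\<psi> j))\<^sup>2) j) i"
    by (intro sum_out_mono transfer_boundD[OF L(1) \<psi>B2])
  also have "\<dots> = d\<^sup>2 * sum_out (B1 - A2) (sum_out A2 (\<lambda>j. (norm (\<psi> j))\<^sup>2)) i"
    by (simp add: sum_out_const_mult)
  also have "sum_out (B1 - A2) (sum_out A2 (\<lambda>j. (norm (\<psi> j))\<^sup>2)) i
      = sum_out ((B1 - A2) \<union> A2) (\<lambda>j. (norm (\<psi> j))\<^sup>2) i"
    using fin by (subst sum_out_Un) auto
  also have "(B1 - A2) \<union> A2 = (A2 - B1) \<union> B1" by auto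
  also have "sum_out ((A2 - B1) \<union> B1) (\<lambda>j. (norm (\<psi> j))\<^sup>2) i
      = sum_out (A2 - B1) (sum_out B1 (\<lambda>j. (norm (\<psi> j))\<^sup>2)) i"
    using fin by (subst sum_out_Un) auto
  also have "d\<^sup>2 * \<dots> \<le> d\<^sup>2 * sum_out (A2 - B1) (\<lambda>j. c\<^sup>2 * sum_out A1 (\<lambda>j. (norm (\<phi> j))\<^sup>2) j) i"
    unfolding \<psi>_def by (intro mult_left_mono sum_out_mono transfer_boundD[OF K(1) \<phi>B1]) auto
  also have "\<dots> = (c * d)\<^sup>2 * sum_out (A2 - B1) (sum_out A1 (\<lambda>j. (norm (\<phi> j))\<^sup>2)) i"
    by (simp add: sum_out_const_mult power_mult_distrib)
  also have "sum_out (A2 - B1) (sum_out A1 (\<lambda>j. (norm (\<phi> j))\<^sup>2)) i = sum_out A (\<lambda>j. (norm (\<phi> j))\<^sup>2) i"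
    unfolding A_def using fin disj by (subst Un_commute, subst sum_out_Un) auto
  also have "\<dots> = sum_out A (\<lambda>j. (norm (\<phi>0 j))\<^sup>2) i"
  proof (rule sum_out_cong)
    fix j assume j: "\<And>w. w \<notin> A \<Longrightarrow> j w = i w"
    have "\<phi>0 j = \<phi> j" by (rule \<phi>eq) (use j dAW in auto)
    then show "(norm (\<phi> j))\<^sup>2 = (norm (\<phi>0 j))\<^sup>2" by simp
  qed
  finally show "sum_out (B2 \<union> (B1 - A2))
          (\<lambda>j. (norm (sum_out (A1 \<union> (A2 - B1)) (\<lambda>l. sum_out (B1 \<inter> A2) (\<lambda>i. K i * L i) l * \<phi>0 l) j))\<^sup>2) i
     \<le> (c * d)\<^sup>2 * sum_out (A1 \<union> (A2 - B1)) (\<lambda>j. (norm (\<phi>0 j))\<^sup>2) i"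
    by (simp only: A_def B_def W_def)
qed

text \<open>
  The kernel of a part of the graph that hangs on the rest of the graph by the vertices \<open>N\<close>. With \<open>v\<close>
  pinned, it is bounded however the other attaching vertices are divided into consumed, produced and
  pinned ones. This freedom is what lets such parts be applied one after the other in any order.
\<close>

definition pinned_bound ::
    "'a \<Rightarrow> 'a set \<Rightarrow> (('a \<Rightarrow> 'n::finite) \<Rightarrow> complex) \<Rightarrow> real \<Rightarrow> bool" where
  "pinned_bound v N K c \<longleftrightarrow> finite N \<and> indep (- N) K \<and>
     (\<forall>A B. A \<inter> B = {} \<longrightarrow> A \<union> B \<subseteq> N - {v} \<longrightarrow> transfer_bound A B K c)"

lemma transfer_bound_const: "norm k \<le> c \<Longrightarrow> transfer_bound {} {} (\<lambda>i. k) c"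
  unfolding transfer_bound_def
  by (simp add: norm_mult power_mult_distrib mult_right_mono power_mono)

lemma pinned_bound_const: "norm k \<le> c \<Longrightarrow> pinned_bound v {} (\<lambda>i. k) c"
  unfolding pinned_bound_def using transfer_bound_const[of k c] by (simp add: indep_const)

lemma pinned_bound_mono: "pinned_bound v N K c \<Longrightarrow> 0 \<le> c \<Longrightarrow> c \<le> d \<Longrightarrow> pinned_bound v N K d"
  unfolding pinned_bound_def by (meson transfer_bound_mono)

text \<open>
  A pinned part followed by an operator \<open>L\<close>. The first operator consumes what \<open>L\<close> does not see and
  produces what it can; everything else is left to \<open>L\<close>. The set \<open>V\<close> is empty or \<open>{v}\<close>: in the second
  case \<open>L\<close> consumes the pinned vertex.
\<close>

lemma pinned_bound_last:
  fixes K L :: "('a \<Rightarrow> 'n::finite) \<Rightarrow> complex"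
  assumes K: "pinned_bound v N K c"
    and NL: "finite NL" "indep (- NL) L"
    and AB: "A \<inter> B = {}" "A \<union> B \<subseteq> (N \<union> NL) - {v}" and V: "V \<subseteq> {v}"
    and L: "transfer_bound ((A \<inter> NL) \<union> V) (B - N) L d"
  shows "transfer_bound (A \<union> V) B (\<lambda>i. K i * L i) (c * d)"
proof -
  have N: "finite N" "indep (- N) K" using K by (auto simp: pinned_bound_def)
  have finV: "finite V" using V finite_subset by blast
  have finAB: "finite A" "finite B" using AB(2) N(1) NL(1) by (auto intro: finite_subset)
  have "(A - NL) \<inter> (B \<inter> N) = {}" "(A - NL) \<union> (B \<inter> N) \<subseteq> N - {v}" using AB by auto
  with K have "transfer_bound (A - NL) (B \<inter> N) K c"
    unfolding pinned_bound_def by blast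
  moreover have "indep (B - N) K" by (rule indep_subset[OF N(2)]) auto
  moreover have "indep (A - NL) L" by (rule indep_subset[OF NL(2)]) auto
  ultimately have "transfer_bound ((A - NL) \<union> (((A \<inter> NL) \<union> V) - (B \<inter> N)))
      ((B - N) \<union> ((B \<inter> N) - ((A \<inter> NL) \<union> V)))
       (sum_out ((B \<inter> N) \<inter> ((A \<inter> NL) \<union> V)) (\<lambda>i. K i * L i)) (c * d)"
    using finAB finV AB V L by (intro transfer_bound_comp) auto
  moreover have "(A - NL) \<union> (((A \<inter> NL) \<union> V) - (B \<inter> N)) = A \<union> V" using AB V by auto
  moreover have "(B - N) \<union> ((B \<inter> N) - ((A \<inter> NL) \<union> V)) = B" using AB V by auto
  moreover have "(B \<inter> N) \<inter> ((A \<inter> NL) \<union> V) = {}" using AB V by auto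
  moreover have "sum_out {} (\<lambda>i. K i * L i) = (\<lambda>i. K i * L i)" by (rule ext) simp
  ultimately show ?thesis by simp
qed

lemma pinned_bound_mult:
  assumes "pinned_bound v N K c" "pinned_bound v N' L d"
  shows "pinned_bound v (N \<union> N') (\<lambda>i. K i * L i) (c * d)"
  unfolding pinned_bound_def
proof (intro conjI allI impI)
  have *: "finite N'" "indep (- N') L" "finite N" "indep (- N) K" using assms
    by (auto simp: pinned_bound_def)
  then show "finite (N \<union> N')" by simp
  show "indep (- (N \<union> N')) (\<lambda>i. K i * L i)"
    by (intro indep_comp2[of _ _ _ "(*)"] indep_subset[OF *(2)] indep_subset[OF *(4)]) auto
  fix A B assume AB: "A \<inter> B = {}" "A \<union> B \<subseteq> (N \<union> N') - {v}"
  have "(A \<inter> N') \<inter> (B - N) = {}" "(A \<inter> N') \<union> (B - N) \<subseteq> N' - {v}" using AB by auto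
  with assms(2) have "transfer_bound ((A \<inter> N') \<union> {}) (B - N) L d"
    unfolding pinned_bound_def Un_empty_right by blast
  from pinned_bound_last[OF assms(1) *(1,2) AB _ this]
  show "transfer_bound A B (\<lambda>i. K i * L i) (c * d)" by simp
qed

lemma pinned_bound_prod:
  assumes "finite E" "\<And>e. e \<in> E \<Longrightarrow> pinned_bound v (N e) (K e) (c e)"
  shows "pinned_bound v (\<Union>e\<in>E. N e) (\<lambda>i. \<Prod>e\<in>E. K e i) (\<Prod>e\<in>E. c e)"
  using assms
proof (induction E rule: finite_induct)
  case empty
  then show ?case using pinned_bound_const[of 1 1 v] by simp
next
  case (insert e E)
  then show ?case
    using pinned_bound_mult[of v "N e" "K e" "c e" "\<Union>e\<in>E. N e" "\<lambda>i. \<Prod>e\<in>E. K e i" "\<Prod>e\<in>E. c e"]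
    by simp
qed

text \<open>
  Creates the index \<open>v\<close> by \<open>K\<close> and sums it out by \<open>L\<close>. The consumed variables in \<open>A'\<close> are left to \<open>L\<close>.
\<close>

lemma transfer_bound_first:
  fixes K L :: "('a \<Rightarrow> 'n::finite) \<Rightarrow> complex"
  assumes fin: "finite A" "finite B" and AB: "A \<inter> B = {}" "v \<notin> A \<union> B"
    and A': "A' \<subseteq> A"
    and K: "transfer_bound (A - A') {v} K c" "indep B K"
    and L: "transfer_bound (A' \<union> {v}) B L d" "indep (A - A') L"
  shows "transfer_bound A B (sum_out {v} (\<lambda>i. K i * L i)) (c * d)"
proof -
  have fA: "finite A'" "finite (A - A')" using A' fin finite_subset by auto
  have "transfer_bound ((A - A') \<union> ((A' \<union> {v}) - {v})) (B \<union> ({v} - (A' \<union> {v})))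
       (sum_out ({v} \<inter> (A' \<union> {v})) (\<lambda>i. K i * L i)) (c * d)"
    using fin fA AB K L A' by (intro transfer_bound_comp) auto
  moreover have "(A - A') \<union> ((A' \<union> {v}) - {v}) = A" "B \<union> ({v} - (A' \<union> {v})) = B"
    "{v} \<inter> (A' \<union> {v}) = {v}" using AB A' by auto
  ultimately show ?thesis by simp
qed

text \<open>
  The constant kernel is the vector of ones, of norm \<open>\<surd>N\<close>, used as a state and, in the next lemma, as a
  functional. These two are the only sources of powers of \<open>N\<close> in the upper bound.
\<close>

lemma transfer_bound_one_produce:
  "transfer_bound {} {v} (\<lambda>i::'a \<Rightarrow> 'n::finite. 1) (sqrt (real CARD('n)))"
  unfolding transfer_bound_def
proof (intro allI impI)
  fix \<phi> :: "('a \<Rightarrow> 'n) \<Rightarrow> complex" and i assume \<phi>: "indep {v} \<phi>"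
  have "\<phi> (i(v := k)) = \<phi> i" for k by (rule indepD[OF \<phi>]) auto
  then show "sum_out {v} (\<lambda>j. (norm (sum_out {} (\<lambda>l. 1 * \<phi> l) j))\<^sup>2) i
         \<le> (sqrt (real CARD('n)))\<^sup>2 * sum_out {} (\<lambda>j. (norm (\<phi> j))\<^sup>2) i"
    by (simp add: sum_out_singleton)
qed

lemma transfer_bound_one_consume:
  "transfer_bound {v} {} (\<lambda>i::'a \<Rightarrow> 'n::finite. 1) (sqrt (real CARD('n)))"
  unfolding transfer_bound_def
proof (intro allI impI)
  fix \<phi> :: "('a \<Rightarrow> 'n) \<Rightarrow> complex" and i
  have "(norm (\<Sum>k\<in>UNIV. \<phi> (i(v := k))))\<^sup>2 \<le> (\<Sum>k\<in>UNIV. norm (\<phi> (i(v := k))) * 1)\<^sup>2"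
    by (intro power_mono) (auto intro: norm_sum)
  also have "\<dots> \<le> (\<Sum>k\<in>UNIV. (norm (\<phi> (i(v := k))))\<^sup>2) * (\<Sum>k\<in>(UNIV :: 'n set). 1\<^sup>2)"
    by (rule Cauchy_Schwarz_ineq_sum)
  finally show "sum_out {} (\<lambda>j. (norm (sum_out {v} (\<lambda>l. 1 * \<phi> l) j))\<^sup>2) i
         \<le> (sqrt (real CARD('n)))\<^sup>2 * sum_out {v} (\<lambda>j. (norm (\<phi> j))\<^sup>2) i"
    by (simp add: sum_out_singleton mult.commute)
qed

lemma norm_vec_sq: "(norm (x :: complex^'n))\<^sup>2 = (\<Sum>k\<in>UNIV. (norm (x $ k))\<^sup>2)"
  by (simp add: norm_vec_def L2_set_def sum_nonneg)

lemma op_norm_nonneg: "0 \<le> op_norm (M :: complex^'n^'m)"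
  unfolding op_norm_def by (rule onorm_pos_le) (rule matrix_vector_mul_bounded_linear)

lemma op_norm_entries:
  fixes M :: "complex^'n^'m"
  shows "(\<Sum>a\<in>UNIV. (norm (\<Sum>b\<in>UNIV. M $ a $ b * f b))\<^sup>2) \<le> (op_norm M)\<^sup>2 * (\<Sum>b\<in>UNIV. (norm (f b))\<^sup>2)"
proof -
  have "norm (M *v vec_lambda f) \<le> op_norm M * norm (vec_lambda f)"
    unfolding op_norm_def by (rule onorm) (rule matrix_vector_mul_bounded_linear)
  then have "(norm (M *v vec_lambda f))\<^sup>2 \<le> (op_norm M * norm (vec_lambda f))\<^sup>2"
    by (intro power_mono) auto
  then show ?thesis by (simp add: norm_vec_sq power_mult_distrib matrix_vector_mult_def)
qed

text \<open>
  A matrix and its transpose have the same norm: with \<open>h = M\<^sup>T g\<close>, the pairing of \<open>h\<close> with its own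
  conjugate equals the pairing of \<open>g\<close> with \<open>M\<close> applied to that conjugate. Edges can thus be used against
  their orientation.
\<close>

lemma op_norm_entries_transpose:
  fixes M :: "complex^'n^'m"
  shows "(\<Sum>b\<in>UNIV. (norm (\<Sum>a\<in>UNIV. M $ a $ b * g a))\<^sup>2) \<le> (op_norm M)\<^sup>2 * (\<Sum>a\<in>UNIV. (norm (g a))\<^sup>2)"
proof -
  define h where "h b = (\<Sum>a\<in>UNIV. M $ a $ b * g a)" for b
  define s where "s = (\<Sum>b\<in>UNIV. (norm (h b))\<^sup>2)"
  have s0: "0 \<le> s" by (simp add: s_def sum_nonneg)
  have "complex_of_real s = (\<Sum>b\<in>UNIV. h b * cnj (h b))"
    unfolding s_def of_real_sum by (simp only: complex_norm_square)
  also have "\<dots> = (\<Sum>b\<in>UNIV. \<Sum>a\<in>UNIV. g a * (M $ a $ b * cnj (h b)))"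
    by (rule sum.cong[OF refl], subst (1) h_def) (simp add: sum_distrib_left sum_distrib_right ac_simps)
  also have "\<dots> = (\<Sum>a\<in>UNIV. g a * (\<Sum>b\<in>UNIV. M $ a $ b * cnj (h b)))"
    by (subst sum.swap) (simp add: sum_distrib_left)
  finally have "s = norm (\<Sum>a\<in>UNIV. g a * (\<Sum>b\<in>UNIV. M $ a $ b * cnj (h b)))"
    using s0 by (metis norm_of_real abs_of_nonneg)
  also have "\<dots> \<le> (\<Sum>a\<in>UNIV. norm (g a) * norm (\<Sum>b\<in>UNIV. M $ a $ b * cnj (h b)))"
    by (rule order_trans[OF norm_sum]) (simp add: norm_mult)
  finally have "s\<^sup>2 \<le> (\<Sum>a\<in>UNIV. norm (g a) * norm (\<Sum>b\<in>UNIV. M $ a $ b * cnj (h b)))\<^sup>2"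
    using s0 by (intro power_mono)
  also have "\<dots> \<le> (\<Sum>a\<in>UNIV. (norm (g a))\<^sup>2) * (\<Sum>a\<in>UNIV. (norm (\<Sum>b\<in>UNIV. M $ a $ b * cnj (h b)))\<^sup>2)"
    by (rule Cauchy_Schwarz_ineq_sum)
  also have "\<dots> \<le> (\<Sum>a\<in>UNIV. (norm (g a))\<^sup>2) * ((op_norm M)\<^sup>2 * (\<Sum>b\<in>UNIV. (norm (cnj (h b)))\<^sup>2))"
    by (intro mult_left_mono op_norm_entries) (simp add: sum_nonneg)
  finally have "s * s \<le> ((op_norm M)\<^sup>2 * (\<Sum>a\<in>UNIV. (norm (g a))\<^sup>2)) * s"
    by (simp add: s_def power2_eq_square ac_simps)
  then have "s \<le> (op_norm M)\<^sup>2 * (\<Sum>a\<in>UNIV. (norm (g a))\<^sup>2)"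
    using s0 by (cases "s = 0") (auto simp: sum_nonneg)
  then show ?thesis by (simp add: s_def h_def)
qed

text \<open>
  A norm bound for a matrix also bounds the Euclidean norms of its rows and columns and the moduli of
  its entries; these are the cases in which an end of an edge is pinned.
\<close>

lemma transfer_bound_kernel:
  fixes k :: "'n::finite \<Rightarrow> 'n \<Rightarrow> complex"
  assumes bound: "\<And>f. (\<Sum>a\<in>UNIV. (norm (\<Sum>b\<in>UNIV. k a b * f b))\<^sup>2) \<le> c\<^sup>2 * (\<Sum>b\<in>UNIV. (norm (f b))\<^sup>2)"
    and "x \<noteq> v" "A \<subseteq> {x}" "B \<subseteq> {v}"
  shows "transfer_bound A B (\<lambda>i. k (i v) (i x)) c"
  unfolding transfer_bound_def
proof (intro allI impI)
  fix \<phi> :: "('a \<Rightarrow> 'n) \<Rightarrow> complex" and i assume \<phi>: "indep B \<phi>"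
  have b1: "(norm (\<Sum>b\<in>UNIV. k a b * f b))\<^sup>2 \<le> c\<^sup>2 * (\<Sum>b\<in>UNIV. (norm (f b))\<^sup>2)" for a f
    by (rule order_trans[OF _ bound[of f]]) (rule member_le_sum, auto)
  have b2: "(\<Sum>a\<in>UNIV. (norm (k a b * y))\<^sup>2) \<le> c\<^sup>2 * (norm y)\<^sup>2" for b y
    using bound[of "\<lambda>b'. if b' = b then y else 0"]
    by (simp add: if_distrib[of norm] if_distrib[of "\<lambda>t. t\<^sup>2"] if_distrib[of "\<lambda>t. _ * t"] cong: if_cong)
  have b3: "(norm (k a b * y))\<^sup>2 \<le> c\<^sup>2 * (norm y)\<^sup>2" for a b y
    by (rule order_trans[OF _ b2[of b y]]) (rule member_le_sum[of _ _ "\<lambda>a. (norm (k a b * y))\<^sup>2"], auto)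
  have "A = {} \<or> A = {x}" "B = {} \<or> B = {v}" using assms by auto
  then consider "A = {}" "B = {}" | "A = {x}" "B = {}" | "A = {}" "B = {v}" | "A = {x}" "B = {v}"
    by auto
  then show "sum_out B (\<lambda>j. (norm (sum_out A (\<lambda>l. k (l v) (l x) * \<phi> l) j))\<^sup>2) i
         \<le> c\<^sup>2 * sum_out A (\<lambda>j. (norm (\<phi> j))\<^sup>2) i"
  proof cases
    case 1
    then show ?thesis using b3 by simp
  next
    case 2
    then show ?thesis using b1[of "i v" "\<lambda>b. \<phi> (i(x := b))"] \<open>x \<noteq> v\<close> by (simp add: sum_out_singleton)
  next
    case 3
    then have "\<phi> (i(v := a)) = \<phi> i" for a by (intro indepD[OF \<phi>]) auto
    then show ?thesis using 3 b2[of "i x" "\<phi> i"] \<open>x \<noteq> v\<close> by (simp add: sum_out_singleton)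
  next
    case 4
    then have "\<phi> (i(v := a, x := b)) = \<phi> (i(x := b))" for a b by (intro indepD[OF \<phi>]) auto
    then show ?thesis using 4 bound[of "\<lambda>b. \<phi> (i(x := b))"] \<open>x \<noteq> v\<close> by (simp add: sum_out_singleton)
  qed
qed

lemma op_norm_entry: "norm (M $ a $ b) \<le> op_norm (M :: complex^'n^'m)"
proof -
  have "(\<Sum>a'\<in>UNIV. (norm (M $ a' $ b))\<^sup>2) \<le> (op_norm M)\<^sup>2"
    using op_norm_entries[of M "\<lambda>b'. if b' = b then 1 else 0"]
    by (simp add: if_distrib[of norm] if_distrib[of "\<lambda>t. t\<^sup>2"] if_distrib[of "\<lambda>t. _ * t"] cong: if_cong)
  then have "(norm (M $ a $ b))\<^sup>2 \<le> (op_norm M)\<^sup>2"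
    by (rule order_trans[rotated]) (rule member_le_sum[of a UNIV "\<lambda>a. (norm (M $ a $ b))\<^sup>2"], auto)
  then show ?thesis by (rule power2_le_imp_le) (rule op_norm_nonneg)
qed

section \<open>Cuts and connected vertex sets\<close>

definition boundary :: "('a, 'b) pre_digraph \<Rightarrow> 'a set \<Rightarrow> 'b set" where
  "boundary G A = {e \<in> arcs G. (tail G e \<in> A) \<noteq> (head G e \<in> A)}"

definition incident :: "('a, 'b) pre_digraph \<Rightarrow> 'a set \<Rightarrow> 'b set" where
  "incident G A = {e \<in> arcs G. tail G e \<in> A \<or> head G e \<in> A}"

text \<open>
  The subgraph induced on \<open>B\<close> is connected. The formulation by cuts avoids paths altogether: an edge
  incident to two disjoint sets is one that joins them.
\<close>

definition connected_set :: "('a, 'b) pre_digraph \<Rightarrow> 'a set \<Rightarrow> bool" where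
  "connected_set G B \<longleftrightarrow> B \<noteq> {} \<and>
     (\<forall>A \<subseteq> B. A \<noteq> {} \<longrightarrow> A \<noteq> B \<longrightarrow> incident G A \<inter> incident G (B - A) \<noteq> {})"

lemma connected_setE:
  assumes "connected_set G B" "A \<subseteq> B" "A \<noteq> {}" "A \<noteq> B"
  obtains e where "e \<in> incident G A" "e \<in> incident G (B - A)"
  using assms unfolding connected_set_def by blast

text \<open>
  Connected components of induced subgraphs are called pieces, to tell them from components of the graph.
\<close>

definition piece_of :: "('a, 'b) pre_digraph \<Rightarrow> 'a set \<Rightarrow> 'a set \<Rightarrow> bool" where
  "piece_of G C D \<longleftrightarrow> C \<subseteq> D \<and> connected_set G C \<and> incident G C \<inter> incident G (D - C) = {}"

definition outer_end :: "('a, 'b) pre_digraph \<Rightarrow> 'a set \<Rightarrow> 'b \<Rightarrow> 'a" where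
  "outer_end G B e = (if tail G e \<in> B then head G e else tail G e)"

definition inner_end :: "('a, 'b) pre_digraph \<Rightarrow> 'a set \<Rightarrow> 'b \<Rightarrow> 'a" where
  "inner_end G B e = (if tail G e \<in> B then tail G e else head G e)"

definition neighbours :: "('a, 'b) pre_digraph \<Rightarrow> 'a set \<Rightarrow> 'a set" where
  "neighbours G B = outer_end G B ` boundary G B"

definition ends :: "('a, 'b) pre_digraph \<Rightarrow> 'b \<Rightarrow> 'a set" where
  "ends G e = {tail G e, head G e}"

lemma incident_mono: "A \<subseteq> B \<Longrightarrow> incident G A \<subseteq> incident G B"
  by (auto simp: incident_def)

lemma incident_Un: "incident G (A \<union> B) = incident G A \<union> incident G B"
  by (auto simp: incident_def)

lemma incident_empty [simp]: "incident G {} = {}"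
  by (auto simp: incident_def)

lemma boundary_ends:
  assumes "e \<in> boundary G B"
  shows "inner_end G B e \<in> B" "outer_end G B e \<notin> B" "ends G e = {outer_end G B e, inner_end G B e}"
  using assms by (auto simp: boundary_def inner_end_def outer_end_def ends_def)

lemma neighbours_disjoint: "neighbours G B \<inter> B = {}"
  using boundary_ends(2) by (fastforce simp: neighbours_def)

lemma neighbours_Un:
  assumes "incident G C \<inter> incident G D = {}"
  shows "neighbours G (C \<union> D) = neighbours G C \<union> neighbours G D"
proof -
  have b: "boundary G (C \<union> D) = boundary G C \<union> boundary G D"
    using assms by (auto simp: boundary_def incident_def)
  have "outer_end G (C \<union> D) e = outer_end G C e" if "e \<in> boundary G C" for e
    using assms that by (auto simp: boundary_def incident_def outer_end_def)
  moreover have "outer_end G (C \<union> D) e = outer_end G D e" if "e \<in> boundary G D" for e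
    using assms that by (auto simp: boundary_def incident_def outer_end_def)
  ultimately show ?thesis unfolding neighbours_def b image_Un by (metis (no_types, lifting) image_cong)
qed

lemma connected_set_subset_piece:
  assumes "connected_set G M" "M \<subseteq> D" "incident G C \<inter> incident G (D - C) = {}" "M \<inter> C \<noteq> {}"
  shows "M \<subseteq> C"
proof (rule ccontr)
  assume "\<not> M \<subseteq> C"
  then have "M \<inter> C \<noteq> M" by auto
  with assms have "incident G (M \<inter> C) \<inter> incident G (M - M \<inter> C) \<noteq> {}"
    by (auto simp: connected_set_def)
  moreover have "incident G (M \<inter> C) \<subseteq> incident G C" "incident G (M - M \<inter> C) \<subseteq> incident G (D - C)"
    using assms(2) by (auto intro!: incident_mono)
  ultimately show False using assms(3) by blast
qed

lemma piece_exists: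
  assumes "finite D" "r \<in> D"
  obtains C where "piece_of G C D" "r \<in> C"
proof -
  define P where "P C \<longleftrightarrow> C \<subseteq> D \<and> r \<in> C \<and> incident G C \<inter> incident G (D - C) = {}" for C
  have "P D" using assms by (simp add: P_def)
  then obtain C where C: "P C" and least: "\<And>C'. P C' \<Longrightarrow> card C \<le> card C'"
    using ex_has_least_nat[of P D card] by auto
  have CD: "C \<subseteq> D" "finite C" using C assms finite_subset by (auto simp: P_def)
  have "connected_set G C"
    unfolding connected_set_def
  proof (intro conjI allI impI notI)
    assume "C = {}" then show False using C by (simp add: P_def)
  next
    fix A assume A: "A \<subseteq> C" "A \<noteq> {}" "A \<noteq> C" "incident G A \<inter> incident G (C - A) = {}"
    obtain A' where A': "A' \<subset> C" "r \<in> A'" "incident G A' \<inter> incident G (C - A') = {}"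
    proof (cases "r \<in> A")
      case True then show ?thesis using A that[of A] by auto
    next
      case False
      have "C - (C - A) = A" using A by auto
      then show ?thesis using A C False that[of "C - A"] by (auto simp: P_def)
    qed
    have "D - A' = (C - A') \<union> (D - C)" using A' CD by auto
    then have "incident G A' \<inter> incident G (D - A')
        = (incident G A' \<inter> incident G (C - A')) \<union> (incident G A' \<inter> incident G (D - C))"
      by (auto simp: incident_Un)
    also have "incident G A' \<inter> incident G (D - C) = {}"
      using C A' incident_mono[of A' C G] unfolding P_def by blast
    finally have "P A'" using A' CD by (auto simp: P_def)
    moreover have "card A' < card C" using A' CD psubset_card_mono by blast
    ultimately show False using least by fastforce
  qed
  with C show thesis by (intro that[of C]) (auto simp: P_def piece_of_def)
qed

text \<open>
  A piece without an edge to \<open>v\<close> would be separated from the rest of \<open>B\<close> already.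
\<close>

lemma piece_edge:
  assumes "connected_set G B" "v \<in> B" "piece_of G C (B - {v})"
  obtains e where "e \<in> boundary G C" "outer_end G C e = v"
proof -
  have C: "C \<subseteq> B - {v}" "C \<noteq> {}" "incident G C \<inter> incident G (B - {v} - C) = {}"
    using assms(3) by (auto simp: piece_of_def connected_set_def)
  then have "C \<noteq> B" using assms(2) by auto
  then obtain e where e: "e \<in> incident G C" "e \<in> incident G (B - C)"
    using assms(1) C unfolding connected_set_def by blast
  have "e \<notin> incident G (B - {v} - C)" using C(3) e(1) by auto
  then have "e \<in> boundary G C \<and> outer_end G C e = v"
    using e C(1,2) assms(2) by (auto simp: incident_def boundary_def outer_end_def)
  then show thesis using that by blast
qed

lemma piece_of_subpiece:
  assumes "piece_of G C D" "piece_of G C' (D - C)"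
  shows "piece_of G C' D"
proof -
  have "C' \<subseteq> D - C" using assms(2) by (auto simp: piece_of_def)
  then have t: "incident G C' \<subseteq> incident G (D - C)" by (rule incident_mono)
  have eq: "D - C' = C \<union> (D - C - C')" using assms \<open>C' \<subseteq> D - C\<close> by (auto simp: piece_of_def)
  have "incident G C' \<inter> incident G (D - C') = {}"
    unfolding eq incident_Un using assms t by (auto simp: piece_of_def)
  then show ?thesis using assms by (auto simp: piece_of_def)
qed

section \<open>Graph sums with pinned vertices\<close>

definition entry :: "('a, 'b) pre_digraph \<Rightarrow> ('b \<Rightarrow> complex^'n^'n) \<Rightarrow> 'b \<Rightarrow> ('a \<Rightarrow> 'n) \<Rightarrow> complex" where
  "entry G T e i = T e $ i (head G e) $ i (tail G e)"

text \<open>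
  The part of the graph sum that belongs to \<open>B\<close>: indices on \<open>B\<close> are summed, all edges with an end in \<open>B\<close>
  contribute, and the adjacent vertices outside \<open>B\<close> are pinned by the argument.
\<close>

definition pinned_sum ::
    "('a, 'b) pre_digraph \<Rightarrow> ('b \<Rightarrow> complex^'n^'n) \<Rightarrow> 'a set \<Rightarrow> ('a \<Rightarrow> 'n) \<Rightarrow> complex" where
  "pinned_sum G T B = sum_out B (\<lambda>i. \<Prod>e\<in>incident G B. entry G T e i)"

lemma entry_indep: "ends G e \<inter> Z = {} \<Longrightarrow> indep Z (entry G T e)"
  by (auto simp: indep_def entry_def ends_def)

text \<open>
  An edge carries an index from one end to the other, in either direction.
\<close>

lemma entry_transfer_bound:
  fixes T :: "'b \<Rightarrow> complex^'n^'n"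
  assumes "ends G e = {x, v}" "x \<noteq> v" "A \<subseteq> {x}" "B \<subseteq> {v}"
  shows "transfer_bound A B (entry G T e) (op_norm (T e))"
proof -
  consider "tail G e = x" "head G e = v" | "tail G e = v" "head G e = x"
    using assms by (auto simp: ends_def doubleton_eq_iff)
  then show ?thesis
  proof cases
    case 1
    then have "entry G T e = (\<lambda>i. T e $ i v $ i x)" by (simp add: entry_def fun_eq_iff)
    with transfer_bound_kernel[OF op_norm_entries[of "T e"] assms(2-4)] show ?thesis by simp
  next
    case 2
    then have "entry G T e = (\<lambda>i. T e $ i x $ i v)" by (simp add: entry_def fun_eq_iff)
    with transfer_bound_kernel[of
        "\<lambda>a b. T e $ b $ a", OF op_norm_entries_transpose[of "T e"] assms(2-4)]
    show ?thesis by simp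
  qed
qed

lemma entry_pinned_bound:
  fixes T :: "'b \<Rightarrow> complex^'n^'n"
  assumes "v \<in> ends G e"
  shows "pinned_bound v (ends G e) (entry G T e) (op_norm (T e))"
  unfolding pinned_bound_def
proof (intro conjI allI impI)
  show "finite (ends G e)" by (simp add: ends_def)
  show "indep (- ends G e) (entry G T e)" by (rule entry_indep) auto
  fix A B assume AB: "A \<inter> B = {}" "A \<union> B \<subseteq> ends G e - {v}"
  from assms obtain x where x: "ends G e = {x, v}" by (auto simp: ends_def)
  show "transfer_bound A B (entry G T e) (op_norm (T e))"
  proof (cases "x = v")
    case True
    then have "A = {}" "B = {}" using AB x by auto
    then show ?thesis
      by (auto simp: transfer_bound_def norm_mult power_mult_distrib entry_def intro!: mult_right_mono power_mono op_norm_entry)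
  next
    case False
    have "A = {} \<and> B \<subseteq> {x} \<or> A \<subseteq> {x} \<and> B = {}" using AB x by auto
    then show ?thesis
    proof
      assume "A = {} \<and> B \<subseteq> {x}"
      then show ?thesis using entry_transfer_bound[of G e v x A B T] x False
        by (auto simp: insert_commute)
    next
      assume "A \<subseteq> {x} \<and> B = {}"
      then show ?thesis using entry_transfer_bound[of G e x v A B T] x False by auto
    qed
  qed
qed

lemma pinned_sum_indep: "indep (- neighbours G B) (pinned_sum G T B)"
proof -
  have "indep (- (B \<union> neighbours G B)) (pinned_sum G T B)"
    unfolding pinned_sum_def
  proof (intro indep_sum_out indep_prod entry_indep)
    fix e assume "e \<in> incident G B"
    then show "ends G e \<inter> - (B \<union> neighbours G B) = {}"
      by (auto simp: incident_def ends_def neighbours_def boundary_def outer_end_def image_iff)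
  qed
  moreover have "indep B (pinned_sum G T B)" unfolding pinned_sum_def by (rule indep_sum_out_self)
  ultimately have "indep (- (B \<union> neighbours G B) \<union> B) (pinned_sum G T B)" by (rule indep_Un)
  then show ?thesis by (rule indep_subset) auto
qed

lemma indep_empty: "indep {} f"
  unfolding indep_def by (metis empty_iff ext)

lemma pinned_sum_empty [simp]: "pinned_sum G T {} i = 1"
  by (simp add: pinned_sum_def)

context fin_digraph
begin

lemma finite_incident [simp]: "finite (incident G A)"
  by (simp add: incident_def)

lemma finite_boundary [simp]: "finite (boundary G A)"
  by (simp add: boundary_def)

lemma finite_neighbours [simp]: "finite (neighbours G A)"
  by (simp add: neighbours_def)

lemma pinned_sum_Un:
  assumes "finite C" "finite D" "C \<inter> D = {}" "incident G C \<inter> incident G D = {}"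
  shows "pinned_sum G T (C \<union> D) i = pinned_sum G T C i * pinned_sum G T D i"
proof -
  define PC where "PC = (\<lambda>i. \<Prod>e\<in>incident G C. entry G T e i)"
  define PD where "PD = (\<lambda>i. \<Prod>e\<in>incident G D. entry G T e i)"
  have P: "(\<Prod>e\<in>incident G (C \<union> D). entry G T e j) = PC j * PD j" for j
    unfolding incident_Un PC_def PD_def by (rule prod.union_disjoint) (use assms in auto)
  have iPC: "indep D PC"
    unfolding PC_def
    by (intro indep_prod entry_indep) (use assms(4) in \<open>auto simp: incident_def ends_def\<close>)
  have nbD: "neighbours G D \<inter> C = {}"
    using assms(4)
    by (auto simp: neighbours_def boundary_def outer_end_def incident_def split: if_splits)
  have kD: "indep C (pinned_sum G T D)"
    by (rule indep_subset[OF pinned_sum_indep]) (use nbD in auto)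
  have "pinned_sum G T (C \<union> D) i = sum_out C (sum_out D (\<lambda>j. PC j * PD j)) i"
    unfolding pinned_sum_def P using assms by (intro sum_out_Un)
  also have "sum_out D (\<lambda>j. PC j * PD j) = (\<lambda>j. PC j * pinned_sum G T D j)"
    by (rule ext) (simp add: sum_out_cmult[OF iPC] pinned_sum_def PD_def)
  also have "sum_out C \<dots> i = pinned_sum G T C i * pinned_sum G T D i"
    unfolding sum_out_multc[OF kD] by (simp add: pinned_sum_def PC_def)
  finally show ?thesis .
qed

text \<open>
  The edges at \<open>v\<close>, loops included, whose other end is not one of the other vertices of \<open>B\<close>.
\<close>

definition own_edges :: "'a \<Rightarrow> 'a set \<Rightarrow> 'b set" where
  "own_edges v B = incident G B - incident G (B - {v})"

lemma own_edges_ends: "e \<in> own_edges v B \<Longrightarrow> v \<in> ends G e"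
  by (auto simp: own_edges_def incident_def ends_def)

lemma finite_own_edges [simp]: "finite (own_edges v B)"
  by (simp add: own_edges_def)

lemma incident_own_edges:
  "v \<in> B \<Longrightarrow> incident G B = own_edges v B \<union> incident G (B - {v})"
      "own_edges v B \<inter> incident G (B - {v}) = {}"
  by (auto simp: own_edges_def incident_def)

text \<open>
  The recursion behind the upper bound: once the index at \<open>v\<close> is fixed, the sum over \<open>B\<close> splits into the
  edges owned by \<open>v\<close> and the sum over \<open>B - {v}\<close>, which factorizes over pieces by \<open>pinned_sum_Un\<close>.
\<close>

lemma pinned_sum_remove:
  assumes "finite B" "v \<in> B"
  shows "pinned_sum G T B
      = sum_out {v} (\<lambda>i. (\<Prod>e\<in>own_edges v B. entry G T e i) * pinned_sum G T (B - {v}) i)"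
proof
  fix i
  define PC where "PC = (\<lambda>i. \<Prod>e\<in>own_edges v B. entry G T e i)"
  define PD where "PD = (\<lambda>i. \<Prod>e\<in>incident G (B - {v}). entry G T e i)"
  have P: "(\<Prod>e\<in>incident G B. entry G T e j) = PC j * PD j" for j
    unfolding incident_own_edges(1)[OF assms(2)] PC_def PD_def
    by (rule prod.union_disjoint) (simp_all add: incident_own_edges(2))
  have iPC: "indep (B - {v}) PC"
    unfolding PC_def by (intro indep_prod entry_indep) (auto simp: own_edges_def incident_def ends_def)
  have "B = {v} \<union> (B - {v})" using assms by auto
  then have "pinned_sum G T B i = sum_out ({v} \<union> (B - {v})) (\<lambda>j. PC j * PD j) i"
    unfolding pinned_sum_def P by simp
  also have "\<dots> = sum_out {v} (sum_out (B - {v}) (\<lambda>j. PC j * PD j)) i"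
    using assms by (intro sum_out_Un) auto
  also have "sum_out (B - {v}) (\<lambda>j. PC j * PD j) = (\<lambda>j. PC j * pinned_sum G T (B - {v}) j)"
    by (rule ext) (simp add: sum_out_cmult[OF iPC] pinned_sum_def PD_def)
  finally show "pinned_sum G T B i
      = sum_out {v} (\<lambda>i. (\<Prod>e\<in>own_edges v B. entry G T e i) * pinned_sum G T (B - {v}) i) i"
    by (simp add: PC_def)
qed

lemma own_edges_pinned_bound:
  assumes "E \<subseteq> own_edges v B"
  shows "pinned_bound v (\<Union>e\<in>E. ends G e) (\<lambda>i. \<Prod>e\<in>E. entry G T e i) (\<Prod>e\<in>E. op_norm (T e))"
  using assms own_edges_ends finite_subset[OF assms]
  by (intro pinned_bound_prod entry_pinned_bound) auto

lemma neighbours_remove: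
  assumes "v \<in> B" "w \<in> neighbours G B"
  shows "w \<in> neighbours G (B - {v})
      \<or> (\<exists>e \<in> own_edges v B. e \<in> boundary G B \<and> outer_end G B e = w \<and> w \<in> ends G e)"
  using assms
  by (auto simp: neighbours_def boundary_def outer_end_def own_edges_def incident_def ends_def image_iff split: if_splits)

end

section \<open>The upper bound for a family of leaf sets\<close>

text \<open>
  The upper bound only uses a family \<open>\<L>\<close> of connected vertex sets, one of which lies in every connected
  set that a single edge joins to its complement. The leaves of the forest of two-edge connected
  components form such a family.
\<close>

locale leaf_family = fin_digraph G for G :: "('a, 'b) pre_digraph" +
  fixes T :: "'b \<Rightarrow> complex^'n^'n" and \<L> :: "'a set set"
  assumes finite_leaves: "finite \<L>"
    and connected_set_leaf: "M \<in> \<L> \<Longrightarrow> connected_set G M"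
    and leaf_within: "B \<subseteq> verts G \<Longrightarrow> connected_set G B \<Longrightarrow> card (boundary G B) = 1 \<Longrightarrow> \<exists>M\<in>\<L>. M \<subseteq> B"
begin

definition root_dim :: real where "root_dim = sqrt (real CARD('n))"

definition leaf_count :: "'a set \<Rightarrow> nat" where "leaf_count B = card {M \<in> \<L>. M \<subseteq> B}"

definition norm_prod :: "'b set \<Rightarrow> real" where "norm_prod E = (\<Prod>e\<in>E. op_norm (T e))"

text \<open>
  The target bound for \<open>B\<close>: each leaf set inside \<open>B\<close> costs one factor \<open>\<surd>N\<close>.
\<close>

definition leaf_bound :: "'a set \<Rightarrow> real"
  where "leaf_bound B = root_dim ^ leaf_count B * norm_prod (incident G B)"

lemma root_dim_ge1: "1 \<le> root_dim"
  by (simp add: root_dim_def Suc_le_eq)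

lemma norm_prod_nonneg: "0 \<le> norm_prod E"
  unfolding norm_prod_def by (intro prod_nonneg) (simp add: op_norm_nonneg)

lemma leaf_bound_nonneg: "0 \<le> leaf_bound B"
  unfolding leaf_bound_def using root_dim_ge1 norm_prod_nonneg by simp

lemma norm_prod_Un: "finite E \<Longrightarrow> finite F \<Longrightarrow> E \<inter> F = {} \<Longrightarrow> norm_prod (E \<union> F) = norm_prod E * norm_prod F"
  unfolding norm_prod_def by (rule prod.union_disjoint)

lemma leaf_nonempty: "M \<in> \<L> \<Longrightarrow> M \<noteq> {}"
  using connected_set_leaf by (auto simp: connected_set_def)

lemma leaf_count_pos_iff: "1 \<le> leaf_count B \<longleftrightarrow> (\<exists>M\<in>\<L>. M \<subseteq> B)"
proof -
  have "finite {M \<in> \<L>. M \<subseteq> B}" using finite_leaves by simp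
  then have "leaf_count B = 0 \<longleftrightarrow> {M \<in> \<L>. M \<subseteq> B} = {}" by (simp add: leaf_count_def)
  then show ?thesis by auto
qed

lemma leaf_count_add:
  assumes "C \<inter> D = {}" "C \<union> D \<subseteq> B"
  shows "leaf_count C + leaf_count D \<le> leaf_count B"
proof -
  have "M = {}" if "M \<subseteq> C" "M \<subseteq> D" for M using that assms(1) by blast
  then have "{M \<in> \<L>. M \<subseteq> C} \<inter> {M \<in> \<L>. M \<subseteq> D} = {}" using leaf_nonempty by blast
  then have "leaf_count C + leaf_count D = card ({M \<in> \<L>. M \<subseteq> C} \<union> {M \<in> \<L>. M \<subseteq> D})"
    unfolding leaf_count_def using finite_leaves by (subst card_Un_disjoint) auto
  also have "\<dots> \<le> leaf_count B"
    unfolding leaf_count_def using finite_leaves assms by (intro card_mono) auto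
  finally show ?thesis .
qed

lemma leaf_count_mono: "C \<subseteq> B \<Longrightarrow> leaf_count C \<le> leaf_count B"
  using leaf_count_add[of C "{}" B] by simp

lemma leaf_count_add_leaf:
  assumes "M \<in> \<L>" "M \<subseteq> B" "\<not> M \<subseteq> D" "D \<subseteq> B"
  shows "leaf_count D + 1 \<le> leaf_count B"
proof -
  have "leaf_count D + 1 = card (insert M {M \<in> \<L>. M \<subseteq> D})"
    unfolding leaf_count_def using finite_leaves assms by (subst card_insert_disjoint) auto
  also have "\<dots> \<le> leaf_count B"
    unfolding leaf_count_def using finite_leaves assms by (intro card_mono) auto
  finally show ?thesis .
qed

lemma leaf_bound_Un:
  assumes "C \<inter> D = {}" "incident G C \<inter> incident G D = {}"
  shows "leaf_bound C * leaf_bound D \<le> leaf_bound (C \<union> D)"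
proof -
  have "leaf_bound C * leaf_bound D
      = root_dim ^ (leaf_count C + leaf_count D) * norm_prod (incident G (C \<union> D))"
    using assms by (simp add: leaf_bound_def incident_Un norm_prod_Un power_add)
  also have "\<dots> \<le> root_dim ^ leaf_count (C \<union> D) * norm_prod (incident G (C \<union> D))"
    using leaf_count_add[OF assms(1), of "C \<union> D"] root_dim_ge1
    by (intro mult_right_mono power_increasing norm_prod_nonneg) auto
  finally show ?thesis by (simp add: leaf_bound_def)
qed

text \<open>
  The statement proved by induction on \<open>B\<close>. The edge \<open>e\<close> is a way into \<open>B\<close>, as its outer end is consumed or
  pinned. The second boundary edge \<open>f\<close>, with produced or pinned outer end, is a way out; a leaf set inside
  \<open>B\<close> can take its place because the indices can also be absorbed there at the cost of \<open>\<surd>N\<close>. Without a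
  way out the bound fails already for a single vertex joined to two consumed vertices by identity matrices:
  the functional \<open>\<phi> \<mapsto> \<Sum>\<^sub>k \<phi>(k, k)\<close> has norm \<open>\<surd>N\<close>.
\<close>

definition leaf_transfer :: "'a set \<Rightarrow> bool" where
  "leaf_transfer B \<longleftrightarrow>
      (\<forall>A A' e. A \<inter> A' = {} \<longrightarrow> A \<union> A' \<subseteq> neighbours G B \<longrightarrow> e \<in> boundary G B \<longrightarrow> outer_end G B e \<notin> A' \<longrightarrow>
     (\<exists>f\<in>boundary G B. f \<noteq> e \<and> outer_end G B f \<notin> A) \<or> 1 \<le> leaf_count B \<longrightarrow>
     transfer_bound A A' (pinned_sum G T B) (leaf_bound B))"

lemma leaf_transferD:
  assumes "leaf_transfer B" "A \<inter> A' = {}" "A \<union> A' \<subseteq> neighbours G B" "e \<in> boundary G B"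
      "outer_end G B e \<notin> A'"
     "(\<exists>f\<in>boundary G B. f \<noteq> e \<and> outer_end G B f \<notin> A) \<or> 1 \<le> leaf_count B"
  shows "transfer_bound A A' (pinned_sum G T B) (leaf_bound B)"
  using assms unfolding leaf_transfer_def by blast

text \<open>
  With \<open>v\<close> pinned, the edge from \<open>v\<close> can serve as way in or as way out. If \<open>C\<close> has another boundary edge,
  that edge takes the other role, whatever happens to its outer end. If not, \<open>C\<close> contains a leaf set.
\<close>

lemma piece_pinned_bound:
  assumes C: "leaf_transfer C" "C \<subseteq> verts G" "connected_set G C"
    and e: "e \<in> boundary G C" "outer_end G C e = v"
  shows "pinned_bound v (neighbours G C) (pinned_sum G T C) (leaf_bound C)"
  unfolding pinned_bound_def
proof (intro conjI allI impI)
  show "indep (- neighbours G C) (pinned_sum G T C)" by (rule pinned_sum_indep)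
  fix A A' assume AA: "A \<inter> A' = {}" "A \<union> A' \<subseteq> neighbours G C - {v}"
  then have sub: "A \<union> A' \<subseteq> neighbours G C" and v: "v \<notin> A" "v \<notin> A'" by auto
  show "transfer_bound A A' (pinned_sum G T C) (leaf_bound C)"
  proof (cases "boundary G C = {e}")
    case True
    then have "card (boundary G C) = 1" by simp
    then have "1 \<le> leaf_count C" unfolding leaf_count_pos_iff using leaf_within C by blast
    then show ?thesis using leaf_transferD[OF C(1) AA(1) sub e(1)] e v by auto
  next
    case False
    then obtain g where g: "g \<in> boundary G C" "g \<noteq> e" using e by auto
    show ?thesis
    proof (cases "outer_end G C g \<in> A")
      case True
      then have "outer_end G C g \<notin> A'" using AA by auto
      moreover have "e \<noteq> g \<and> outer_end G C e \<notin> A" using g e v by auto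
      ultimately show ?thesis using leaf_transferD[OF C(1) AA(1) sub g(1)] e(1) by blast
    next
      case False
      then show ?thesis using leaf_transferD[OF C(1) AA(1) sub e(1)] e v g by auto
    qed
  qed
qed simp

lemma pieces_pinned_bound:
  assumes "D \<subseteq> verts G"
    and "\<And>C. piece_of G C D \<Longrightarrow> leaf_transfer C \<and> (\<exists>e\<in>boundary G C. outer_end G C e = v)"
  shows "pinned_bound v (neighbours G D) (pinned_sum G T D) (leaf_bound D)"
proof -
  have "finite D" using assms(1) by (rule finite_subset) simp
  then show ?thesis using assms
  proof (induction D rule: finite_psubset_induct)
    case (psubset D)
    show ?case
    proof (cases "D = {}")
      case True
      have "pinned_sum G T {} = (\<lambda>i. 1)" by (rule ext) simp
      moreover have "1 \<le> leaf_bound {}" using root_dim_ge1 by (simp add: leaf_bound_def norm_prod_def)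
      ultimately show ?thesis
        using pinned_bound_const[of 1 "leaf_bound {}" v] True by (simp add: neighbours_def boundary_def)
    next
      case False
      then obtain r where "r \<in> D" by auto
      then obtain C where C: "piece_of G C D" "r \<in> C" using piece_exists psubset.hyps(1) by metis
      have CD: "C \<subseteq> D" "connected_set G C" "incident G C \<inter> incident G (D - C) = {}"
        using C by (auto simp: piece_of_def)
      have fin: "finite C" "finite (D - C)" using CD psubset.hyps(1) finite_subset by auto
      have m1: "pinned_bound v (neighbours G C) (pinned_sum G T C) (leaf_bound C)"
        using psubset.prems(2)[OF C(1)] piece_pinned_bound CD psubset.prems(1) by blast
      have m2: "pinned_bound v (neighbours G (D - C)) (pinned_sum G T (D - C)) (leaf_bound (D - C))"
      proof (rule psubset.IH)
        show "D - C \<subset> D" using C(2) CD(1) by auto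
        show "D - C \<subseteq> verts G" using psubset.prems by auto
        show "leaf_transfer C' \<and> (\<exists>e\<in>boundary G C'. outer_end G C' e = v)"
          if "piece_of G C' (D - C)" for C'
          using psubset.prems(2) piece_of_subpiece[OF C(1) that] by blast
      qed
      have D: "C \<union> (D - C) = D" using CD by auto
      have "pinned_sum G T D = (\<lambda>i. pinned_sum G T C i * pinned_sum G T (D - C) i)"
        using pinned_sum_Un[OF fin _ CD(3), of T] D by (auto simp: fun_eq_iff)
      moreover have "neighbours G D = neighbours G C \<union> neighbours G (D - C)"
        using neighbours_Un[OF CD(3)] D by simp
      moreover have "leaf_bound C * leaf_bound (D - C) \<le> leaf_bound D"
        using leaf_bound_Un[OF _ CD(3)] D by simp
      ultimately show ?thesis
        using pinned_bound_mono[OF pinned_bound_mult[OF m1 m2]] leaf_bound_nonneg by simp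
    qed
  qed
qed

text \<open>
  Some piece \<open>C\<close> with a way out of its own is applied last. It is entered through the edge from \<open>v\<close>, so
  it consumes \<open>v\<close>; the remaining parts act before it with \<open>v\<close> pinned.
\<close>

lemma piece_consume:
  assumes C: "piece_of G C R" "leaf_transfer C" and R: "R \<subseteq> verts G"
    and all: "\<And>C. piece_of G C R \<Longrightarrow> leaf_transfer C \<and> (\<exists>e\<in>boundary G C. outer_end G C e = v)"
    and E: "E \<subseteq> own_edges v B"
    and AA: "A \<inter> A' = {}" "A \<union> A' \<subseteq> ((\<Union>e\<in>E. ends G e) \<union> neighbours G R) - {v}"
    and end1: "(\<exists>f\<in>boundary G C. outer_end G C f \<notin> A \<union> {v}) \<or> 1 \<le> leaf_count C"
  shows "transfer_bound (A \<union> {v}) A' (\<lambda>i. (\<Prod>e\<in>E. entry G T e i) * pinned_sum G T R i)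
      (norm_prod E * leaf_bound R)"
proof -
  have CR: "C \<subseteq> R" "connected_set G C" "incident G C \<inter> incident G (R - C) = {}" "C \<union> (R - C) = R"
    using C by (auto simp: piece_of_def)
  have fin: "finite C" "finite (R - C)"
    using CR R finite_subset[of R "verts G"] finite_subset[of C R] by auto
  obtain e where e: "e \<in> boundary G C" "outer_end G C e = v" using all[OF C(1)] by auto
  have "pinned_bound v (neighbours G (R - C)) (pinned_sum G T (R - C)) (leaf_bound (R - C))"
    using R all piece_of_subpiece[OF C(1)] by (intro pieces_pinned_bound) auto
  then have m: "pinned_bound v ((\<Union>e\<in>E. ends G e) \<union> neighbours G (R - C))
      (\<lambda>i. (\<Prod>e\<in>E. entry G T e i) * pinned_sum G T (R - C) i) (norm_prod E * leaf_bound (R - C))"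
    unfolding norm_prod_def by (intro pinned_bound_mult own_edges_pinned_bound[OF E])
  have nbR: "neighbours G R = neighbours G C \<union> neighbours G (R - C)" using neighbours_Un[OF CR(3)] CR(4)
    by simp
  have v: "v \<in> neighbours G C" using e by (auto simp: neighbours_def)
  have vA: "v \<notin> A" "v \<notin> A'" using AA by auto
  have "transfer_bound ((A \<inter> neighbours G C) \<union> {v}) (A' - ((\<Union>e\<in>E. ends G e) \<union> neighbours G (R - C)))
      (pinned_sum G T C) (leaf_bound C)"
  proof (rule leaf_transferD[OF C(2) _ _ e(1)])
    show "(A \<inter> neighbours G C \<union> {v}) \<inter> (A' - ((\<Union>e\<in>E. ends G e) \<union> neighbours G (R - C))) = {}"
      using AA by auto
    show "A \<inter> neighbours G C \<union> {v} \<union> (A' - ((\<Union>e\<in>E. ends G e) \<union> neighbours G (R - C))) \<subseteq> neighbours G C"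
      using AA v nbR by auto
    show "outer_end G C e \<notin> A' - ((\<Union>e\<in>E. ends G e) \<union> neighbours G (R - C))" using e vA by auto
    show "(\<exists>f\<in>boundary G C. f \<noteq> e \<and> outer_end G C f \<notin> A \<inter> neighbours G C \<union> {v}) \<or> 1 \<le> leaf_count C"
      using end1 e by auto
  qed
  then have "transfer_bound (A \<union> {v}) A'
      (\<lambda>i. ((\<Prod>e\<in>E. entry G T e i) * pinned_sum G T (R - C) i) * pinned_sum G T C i)
     ((norm_prod E * leaf_bound (R - C)) * leaf_bound C)"
    using AA nbR by (intro pinned_bound_last[OF m _ pinned_sum_indep]) auto
  moreover have "(\<lambda>i. ((\<Prod>e\<in>E. entry G T e i) * pinned_sum G T (R - C) i) * pinned_sum G T C i)
     = (\<lambda>i. (\<Prod>e\<in>E. entry G T e i) * pinned_sum G T R i)"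
    using pinned_sum_Un[OF fin _ CR(3), of T] CR(4) by (auto simp: fun_eq_iff)
  ultimately have c: "transfer_bound (A \<union> {v}) A' (\<lambda>i. (\<Prod>e\<in>E. entry G T e i) * pinned_sum G T R i)
      ((norm_prod E * leaf_bound (R - C)) * leaf_bound C)"
    by simp
  have "(norm_prod E * leaf_bound (R - C)) * leaf_bound C \<le> norm_prod E * leaf_bound R"
    using mult_left_mono[OF leaf_bound_Un[OF _ CR(3)] norm_prod_nonneg[of E]] CR(4)
    by (simp add: ac_simps)
  then show ?thesis
    by (rule transfer_bound_mono[OF c, rotated]) (simp add: norm_prod_nonneg leaf_bound_nonneg)
qed

text \<open>
  The index enters \<open>B\<close> through \<open>e\<close> at the inner end \<open>v\<close> of \<open>e\<close>. The other edges at \<open>v\<close> and the pieces of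
  \<open>B - {v}\<close> are parts hanging on \<open>v\<close>; all but one of them are applied with \<open>v\<close> pinned. The last one must
  consume \<open>v\<close>. If the way out \<open>f\<close> is an edge at \<open>v\<close>, it is this edge; if \<open>f\<close> leaves from a piece, it is that
  piece. If the way out is a leaf set, it is the piece containing the leaf set when there is one; and when
  no piece contains a leaf set, a plain sum over the index at \<open>v\<close>, whose factor \<open>\<surd>N\<close> is paid for by a leaf
  set through \<open>v\<close>.
\<close>

lemma leaf_transfer_holds:
  assumes "B \<subseteq> verts G" "connected_set G B"
  shows "leaf_transfer B"
proof -
  have "finite B" using assms(1) by (rule finite_subset) simp
  then show ?thesis using assms
  proof (induction B rule: finite_psubset_induct)
    case (psubset B)
    show ?case
      unfolding leaf_transfer_def
    proof (intro allI impI)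
      fix A A' e
      assume AA: "A \<inter> A' = {}" "A \<union> A' \<subseteq> neighbours G B"
        and e: "e \<in> boundary G B" "outer_end G B e \<notin> A'"
        and alt: "(\<exists>f\<in>boundary G B. f \<noteq> e \<and> outer_end G B f \<notin> A) \<or> 1 \<le> leaf_count B"
      define v x R where "v = inner_end G B e" and "x = outer_end G B e" and "R = B - {v}"
      have vB: "v \<in> B" "x \<notin> B" "x \<noteq> v" "ends G e = {x, v}"
        using boundary_ends[OF e(1)] by (auto simp: v_def x_def)
      have vA: "v \<notin> A" "v \<notin> A'" and AB: "A \<inter> B = {}" "A' \<inter> B = {}"
        using AA(2) neighbours_disjoint[of G B] vB(1) by auto
      have finA: "finite A" "finite A'" using AA(2) finite_subset[OF _ finite_neighbours] by auto
      define E where "E = own_edges v B - {e}"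
      have eown: "e \<in> own_edges v B"
        using vB e by (auto simp: own_edges_def incident_def boundary_def ends_def)
      have Eown: "E \<subseteq> own_edges v B" "finite E" "insert e E = own_edges v B" "e \<notin> E" using eown
        by (auto simp: E_def)
      have pieces: "leaf_transfer C \<and> (\<exists>e\<in>boundary G C. outer_end G C e = v)"
        if C: "piece_of G C R" for C
      proof
        have "C \<subseteq> R" "connected_set G C" using C by (auto simp: piece_of_def)
        then show "leaf_transfer C" using psubset.IH[of C] psubset.prems vB R_def by blast
        show "\<exists>e\<in>boundary G C. outer_end G C e = v"
          using piece_edge[OF psubset.prems(2) vB(1)] C unfolding R_def by blast
      qed
      have RV: "R \<subseteq> verts G" using psubset.prems by (auto simp: R_def)
      have mR: "pinned_bound v (neighbours G R) (pinned_sum G T R) (leaf_bound R)"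
        using RV pieces by (rule pieces_pinned_bound)
      define NR where "NR = (\<Union>e\<in>E. ends G e) \<union> neighbours G R"
      \<comment> \<open>Only \<open>e\<close> reaches \<open>x\<close> without being one of the remaining parts, which attach to \<open>NR\<close>.\<close>
      have nbB: "neighbours G B \<subseteq> insert x NR"
      proof
        fix w assume "w \<in> neighbours G B"
        from neighbours_remove[OF vB(1) this] show "w \<in> insert x NR"
          by (auto simp: NR_def E_def R_def x_def)
      qed
      define L where "L = (\<lambda>i. (\<Prod>e\<in>E. entry G T e i) * pinned_sum G T R i)"
      have kB: "pinned_sum G T B = sum_out {v} (\<lambda>i. entry G T e i * L i)"
        unfolding pinned_sum_remove[OF psubset.hyps vB(1)] L_def Eown(3)[symmetric] R_def[symmetric]
        using Eown(2,4) by (simp add: mult.assoc)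
      have iL: "indep (- NR) L"
        using pinned_bound_mult[OF own_edges_pinned_bound[OF Eown(1)] mR, of T]
        by (simp add: L_def NR_def pinned_bound_def)
      have A'NR: "A' \<subseteq> NR - {v}" using AA(2) nbB e(2) vA x_def by auto
      have ANR: "A \<inter> NR \<subseteq> NR - {v}" using vA by auto
      have tB: "incident G B = insert e (E \<union> incident G R)" "e \<notin> E \<union> incident G R"
          "E \<inter> incident G R = {}"
        using incident_own_edges[of v B] vB(1) Eown eown by (auto simp: R_def)
      have wB: "norm_prod (incident G B) = op_norm (T e) * (norm_prod E * norm_prod (incident G R))"
        using tB Eown(2) by (simp add: norm_prod_def prod.union_disjoint)
      have RB: "leaf_count R \<le> leaf_count B" by (rule leaf_count_mono) (auto simp: R_def)
      \<comment> \<open>What remains is to run the remaining parts and to consume \<open>v\<close>.\<close>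
      have main: "\<exists>d \<le> root_dim ^ leaf_count B * (norm_prod E * norm_prod (incident G R)). 0 \<le> d
          \<and> transfer_bound ((A \<inter> NR) \<union> {v}) A' L d"
      proof -
        have le: "norm_prod E * leaf_bound R
            \<le> root_dim ^ leaf_count B * (norm_prod E * norm_prod (incident G R))"
          unfolding leaf_bound_def using power_increasing[OF RB root_dim_ge1] norm_prod_nonneg
          by (auto simp: ac_simps intro!: mult_left_mono mult_right_mono mult_nonneg_nonneg)
        have le0: "0 \<le> norm_prod E * leaf_bound R" by (simp add: norm_prod_nonneg leaf_bound_nonneg)
        have via_piece: ?thesis
          if "piece_of G C R" "(\<exists>f\<in>boundary G C. outer_end G C f \<notin> (A \<inter> NR) \<union> {v})
              \<or> 1 \<le> leaf_count C" for C
          using piece_consume[OF that(1) _ RV pieces Eown(1) _ _ that(2),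
              of A'] pieces[OF that(1)] AA ANR A'NR le le0
          unfolding L_def NR_def by blast
        show ?thesis
        proof (cases "\<exists>f\<in>boundary G B. f \<noteq> e \<and> outer_end G B f \<notin> A")
          case True
          then obtain f where f: "f \<in> boundary G B" "f \<noteq> e" "outer_end G B f \<notin> A" by auto
          define y where "y = outer_end G B f"
          have y: "y \<notin> B" "y \<notin> A" "ends G f = {y, inner_end G B f}" "inner_end G B f \<in> B"
            using f boundary_ends[OF f(1)] by (auto simp: y_def)
          show ?thesis
          proof (cases "inner_end G B f = v")
            case True
            then have fE: "f \<in> E"
              using f y vB by (auto simp: E_def own_edges_def incident_def boundary_def ends_def)
            define E' where "E' = E - {f}"
            have E': "E' \<subseteq> own_edges v B" "finite E'" "E = insert f E'" "f \<notin> E'"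
              using Eown fE by (auto simp: E'_def)
            have m: "pinned_bound v ((\<Union>e\<in>E'. ends G e) \<union> neighbours G R)
              (\<lambda>i. (\<Prod>e\<in>E'. entry G T e i) * pinned_sum G T R i) (norm_prod E' * leaf_bound R)"
              unfolding norm_prod_def by (intro pinned_bound_mult own_edges_pinned_bound[OF E'(1)] mR)
            have NRe: "NR = ((\<Union>e\<in>E'. ends G e) \<union> neighbours G R) \<union> {y, v}"
              using E'(3) y(3) True by (auto simp: NR_def)
            have cf: "transfer_bound (((A \<inter> NR) \<inter> {y, v}) \<union> {v})
                (A' - ((\<Union>e\<in>E'. ends G e) \<union> neighbours G R)) (entry G T f) (op_norm (T f))"
            proof (rule entry_transfer_bound)
              show "ends G f = {v, y}" using y(3) True by auto
              show "v \<noteq> y" using y(1) vB(1) by auto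
              show "A \<inter> NR \<inter> {y, v} \<union> {v} \<subseteq> {v}" using y by auto
              show "A' - ((\<Union>e\<in>E'. ends G e) \<union> neighbours G R) \<subseteq> {y}" using A'NR NRe by auto
            qed
            have s1: "(A \<inter> NR) \<inter> A' = {}" using AA(1) by blast
            have s2: "(A \<inter> NR) \<union> A' \<subseteq> (((\<Union>e\<in>E'. ends G e) \<union> neighbours G R) \<union> {y, v}) - {v}"
              using ANR A'NR unfolding NRe by blast
            have f2: "indep (- {y, v}) (entry G T f)" using y(3) True by (intro entry_indep) simp
            have "transfer_bound ((A \<inter> NR) \<union> {v}) A'
                (\<lambda>i. ((\<Prod>e\<in>E'. entry G T e i) * pinned_sum G T R i) * entry G T f i)
               ((norm_prod E' * leaf_bound R) * op_norm (T f))"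
              by (rule pinned_bound_last[OF m _ f2 s1 s2 _ cf]) simp_all
            moreover have "(\<lambda>i. ((\<Prod>e\<in>E'. entry G T e i) * pinned_sum G T R i) * entry G T f i) = L"
              using E' by (auto simp: L_def fun_eq_iff)
            moreover have "(norm_prod E' * leaf_bound R) * op_norm (T f) = norm_prod E * leaf_bound R"
              using E' by (simp add: norm_prod_def)
            ultimately show ?thesis using le le0 by auto
          next
            case False
            then have "inner_end G B f \<in> R" using y by (auto simp: R_def)
            then obtain C where C: "piece_of G C R" "inner_end G B f \<in> C"
              using piece_exists[of R] psubset.hyps R_def by (metis finite_Diff)
            have CB: "C \<subseteq> B" using C by (auto simp: piece_of_def R_def)
            have "f \<in> boundary G C" "outer_end G C f = y"
              using f(1) C(2) CB y(1)
              by (auto simp: boundary_def y_def outer_end_def inner_end_def split: if_splits)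
            moreover have "y \<notin> (A \<inter> NR) \<union> {v}" using y vB by auto
            ultimately show ?thesis using via_piece[OF C(1)] by blast
          qed
        next
          case False
          with alt have lB: "1 \<le> leaf_count B" by auto
          \<comment> \<open>A produced vertex would be the outer end of a way out, as \<open>e\<close> does not lead to one.\<close>
          have A'e: "A' = {}"
          proof (rule ccontr)
            assume "A' \<noteq> {}"
            then obtain y where "y \<in> A'" by auto
            then obtain g where "g \<in> boundary G B" "outer_end G B g = y" using AA(2)
              by (auto simp: neighbours_def)
            then show False using False e(2) \<open>y \<in> A'\<close> AA(1) by auto
          qed
          show ?thesis
          proof (cases "\<exists>M\<in>\<L>. M \<subseteq> R")
            case True
            then obtain M where M: "M \<in> \<L>" "M \<subseteq> R" by auto
            then obtain r where r: "r \<in> M" using leaf_nonempty by blast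
            then obtain C where C: "piece_of G C R" "r \<in> C"
              using piece_exists[of R r] psubset.hyps R_def M by (metis finite_Diff subsetD)
            have "M \<subseteq> C" using connected_set_subset_piece[OF connected_set_leaf[OF M(1)] M(2), of C] C r
              by (auto simp: piece_of_def)
            then have "1 \<le> leaf_count C" unfolding leaf_count_pos_iff using M(1) by blast
            then show ?thesis using via_piece[OF C(1)] by blast
          next
            case False
            then have "leaf_count R = 0" using leaf_count_pos_iff[of R] by auto
            then have cR: "leaf_bound R = norm_prod (incident G R)" by (simp add: leaf_bound_def)
            have m: "pinned_bound v NR L (norm_prod E * leaf_bound R)"
              unfolding NR_def L_def norm_prod_def
              by (intro pinned_bound_mult own_edges_pinned_bound[OF Eown(1)] mR)
            have "transfer_bound ((A \<inter> NR) \<union> {v}) A' (\<lambda>i. L i * 1)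
                ((norm_prod E * leaf_bound R) * root_dim)"
              unfolding root_dim_def using ANR A'e transfer_bound_one_consume
              by (intro pinned_bound_last[OF m, of "{}"]) (auto simp: indep_const)
            moreover have "(norm_prod E * leaf_bound R) * root_dim
                \<le> root_dim ^ leaf_count B * (norm_prod E * norm_prod (incident G R))"
              unfolding cR
              using mult_right_mono[of root_dim "root_dim ^ leaf_count B"
                  "norm_prod E * norm_prod (incident G R)"]
                power_increasing[OF lB root_dim_ge1] norm_prod_nonneg by (simp add: ac_simps)
            moreover have "0 \<le> (norm_prod E * leaf_bound R) * root_dim" using le0 root_dim_ge1 by auto
            ultimately show ?thesis by auto
          qed
        qed
      qed
      then obtain d
        where d: "d \<le> root_dim ^ leaf_count B * (norm_prod E * norm_prod (incident G R))" "0 \<le> d"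
            "transfer_bound ((A \<inter> NR) \<union> {v}) A' L d"
        by blast
      have "transfer_bound A A' (sum_out {v} (\<lambda>i. entry G T e i * L i)) (op_norm (T e) * d)"
      proof (rule transfer_bound_first[OF finA AA(1) _ _ _ _ d(3)])
        show "v \<notin> A \<union> A'" "A \<inter> NR \<subseteq> A" using vA by auto
        show "transfer_bound (A - A \<inter> NR) {v} (entry G T e) (op_norm (T e))"
          using AA(2) nbB by (intro entry_transfer_bound[OF vB(4,3)]) auto
        show "indep A' (entry G T e)" using vB(4) e(2) vA by (intro entry_indep) (auto simp: x_def)
        show "indep (A - A \<inter> NR) L" by (rule indep_subset[OF iL]) auto
      qed
      moreover have "op_norm (T e) * d \<le> leaf_bound B"
        using mult_left_mono[OF d(1) op_norm_nonneg[of "T e"]] by (simp add: leaf_bound_def wB ac_simps)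
      ultimately show "transfer_bound A A' (pinned_sum G T B) (leaf_bound B)"
        unfolding kB using transfer_bound_mono op_norm_nonneg d(2) by (metis mult_nonneg_nonneg)
    qed
  qed
qed

lemma transfer_bound_empty_norm:
  assumes "transfer_bound {} {} K c" "0 \<le> c"
  shows "norm (K i) \<le> c"
proof -
  have "(norm (K i))\<^sup>2 \<le> c\<^sup>2" using transfer_boundD[OF assms(1) indep_const[of _ 1], of i] by simp
  then show ?thesis using assms(2) power2_le_imp_le by blast
qed

text \<open>
  In a whole component no boundary edge leads in, so the index at \<open>v\<close> is created by the vector of ones.
\<close>

lemma component_setup:
  assumes B: "B \<subseteq> verts G" "connected_set G B" and v: "v \<in> B"
    and d: "transfer_bound {v} {}
        (\<lambda>i. (\<Prod>e\<in>own_edges v B. entry G T e i) * pinned_sum G T (B - {v}) i) d" "0 \<le> d"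
  shows "norm (pinned_sum G T B i) \<le> root_dim * d"
proof -
  have fB: "finite B" using B(1) by (rule finite_subset) simp
  have "transfer_bound {} {}
      (sum_out {v} (\<lambda>i. 1 * ((\<Prod>e\<in>own_edges v B. entry G T e i) * pinned_sum G T (B - {v}) i))) (root_dim * d)"
    using d transfer_bound_one_produce unfolding root_dim_def
    by (intro transfer_bound_first[of _ _ _ "{}"]) (auto simp: indep_const indep_empty)
  then have "transfer_bound {} {} (pinned_sum G T B) (root_dim * d)"
    by (simp add: pinned_sum_remove[OF fB v])
  then show ?thesis using d(2) root_dim_ge1 by (intro transfer_bound_empty_norm) auto
qed

lemma component_pieces:
  assumes B: "B \<subseteq> verts G" "connected_set G B" and v: "v \<in> B" and C: "piece_of G C (B - {v})"
  shows "leaf_transfer C \<and> (\<exists>e\<in>boundary G C. outer_end G C e = v)"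
proof -
  have "C \<subseteq> verts G" "connected_set G C" using C B by (auto simp: piece_of_def)
  then show ?thesis using leaf_transfer_holds piece_edge[OF B(2) v C] by metis
qed

lemma component_norm_prod:
  assumes "v \<in> B"
  shows "norm_prod (own_edges v B) * leaf_bound (B - {v})
      = root_dim ^ leaf_count (B - {v}) * norm_prod (incident G B)"
  using incident_own_edges[of v B] assms by (simp add: leaf_bound_def norm_prod_Un)

text \<open>
  Creating the index at \<open>v\<close> and summing it out at the end gives the factor \<open>\<surd>N \<cdot> \<surd>N\<close> of a trivial tree.
\<close>

lemma component_bound:
  assumes B: "B \<subseteq> verts G" "connected_set G B"
  shows "norm (pinned_sum G T B i) \<le> root_dim\<^sup>2 * leaf_bound B"
proof -
  obtain v where v: "v \<in> B" using B by (auto simp: connected_set_def)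
  define R where "R = B - {v}"
  have m: "pinned_bound v ((\<Union>e\<in>own_edges v B. ends G e) \<union> neighbours G R)
     (\<lambda>i. (\<Prod>e\<in>own_edges v B. entry G T e i) * pinned_sum G T R i) (norm_prod (own_edges v B) * leaf_bound R)"
    unfolding norm_prod_def R_def using B component_pieces[OF B v]
    by (intro pinned_bound_mult own_edges_pinned_bound[OF subset_refl] pieces_pinned_bound) auto
  have "transfer_bound ({} \<union> {v}) {}
      (\<lambda>i. ((\<Prod>e\<in>own_edges v B. entry G T e i) * pinned_sum G T R i) * 1) ((norm_prod (own_edges v B) * leaf_bound R) * root_dim)"
    unfolding root_dim_def using transfer_bound_one_consume
    by (intro pinned_bound_last[OF m, of "{}"]) (auto simp: indep_const)
  then have "norm (pinned_sum G T B i)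
      \<le> root_dim * ((norm_prod (own_edges v B) * leaf_bound R) * root_dim)"
    unfolding R_def using root_dim_ge1 norm_prod_nonneg leaf_bound_nonneg
    by (intro component_setup[OF B v]) auto
  also have "\<dots> = root_dim\<^sup>2 * (root_dim ^ leaf_count R * norm_prod (incident G B))"
    using component_norm_prod[OF v] by (simp add: R_def power2_eq_square)
  also have "\<dots> \<le> root_dim\<^sup>2 * leaf_bound B"
    unfolding leaf_bound_def using root_dim_ge1 leaf_count_mono[of R B] norm_prod_nonneg
    by (intro mult_left_mono mult_right_mono power_increasing) (auto simp: R_def)
  finally show ?thesis .
qed

text \<open>
  The starting vertex is chosen in the leaf set \<open>M\<close>, which therefore pays for the factor \<open>\<surd>N\<close> of the
  vector of ones and is not counted among the leaf sets of \<open>B - {v}\<close>. The other leaf set lies in a piece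
  that provides the way out.
\<close>

lemma component_bound_leaves:
  assumes B: "B \<subseteq> verts G" "connected_set G B"
    and M: "M \<in> \<L>" "M \<subseteq> B" and M': "M' \<in> \<L>" "M' \<subseteq> B" "M \<inter> M' = {}"
  shows "norm (pinned_sum G T B i) \<le> leaf_bound B"
proof -
  obtain v where v: "v \<in> M" "v \<in> B" using M leaf_nonempty by blast
  define R where "R = B - {v}"
  have fR: "finite R" "R \<subseteq> verts G" using B(1) finite_subset[OF B(1)] by (auto simp: R_def)
  have MR: "M' \<subseteq> R" using M' v by (auto simp: R_def)
  obtain r where r: "r \<in> M'" using M' leaf_nonempty by blast
  then obtain C where C: "piece_of G C R" "r \<in> C"
    using piece_exists[OF fR(1), of r] MR by auto
  have "M' \<subseteq> C" using connected_set_subset_piece[OF connected_set_leaf[OF M'(1)] MR, of C] C r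
    by (auto simp: piece_of_def)
  then have lC: "1 \<le> leaf_count C" unfolding leaf_count_pos_iff using M'(1) by blast
  have pieces: "leaf_transfer C \<and> (\<exists>e\<in>boundary G C. outer_end G C e = v)" if "piece_of G C R" for C
    using component_pieces[OF B v(2)] that by (simp add: R_def)
  have "transfer_bound ({} \<union> {v}) {} (\<lambda>i. (\<Prod>e\<in>own_edges v B. entry G T e i) * pinned_sum G T R i)
      (norm_prod (own_edges v B) * leaf_bound R)"
    using pieces C lC by (intro piece_consume[OF C(1) _ fR(2)]) auto
  then have "norm (pinned_sum G T B i) \<le> root_dim * (norm_prod (own_edges v B) * leaf_bound R)"
    unfolding R_def using norm_prod_nonneg leaf_bound_nonneg by (intro component_setup[OF B v(2)]) auto
  also have "\<dots> = root_dim ^ (leaf_count R + 1) * norm_prod (incident G B)"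
    using component_norm_prod[OF v(2)] by (simp add: R_def)
  also have "\<dots> \<le> leaf_bound B"
    unfolding leaf_bound_def using root_dim_ge1 leaf_count_add_leaf[OF M, of R] v norm_prod_nonneg
    by (intro mult_right_mono power_increasing) (auto simp: R_def)
  finally show ?thesis .
qed

end

text \<open>
  The family \<open>\<L>0\<close> collects the components that are two-edge connected, whose trees are trivial.
\<close>

locale exhaustive_leaf_family = leaf_family G T \<L> for G :: "('a, 'b) pre_digraph"
  and T :: "'b \<Rightarrow> complex^'n^'n" and \<L> +
  fixes \<L>0 :: "'a set set"
  assumes finite_trivial: "finite \<L>0" and trivial_nonempty: "{} \<notin> \<L>0"
    and component_cases: "B \<subseteq> verts G \<Longrightarrow> connected_set G B \<Longrightarrow> boundary G B = {} \<Longrightarrow>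
       B \<in> \<L>0 \<or> (\<exists>M\<in>\<L>. \<exists>M'\<in>\<L>. M \<subseteq> B \<and> M' \<subseteq> B \<and> M \<inter> M' = {})"
begin

definition closed_count :: "'a set \<Rightarrow> nat" where "closed_count D = card {Q \<in> \<L>0. Q \<subseteq> D}"

lemma closed_count_add:
  assumes "C \<inter> D = {}" "C \<union> D \<subseteq> B"
  shows "closed_count C + closed_count D \<le> closed_count B"
proof -
  have "M = {}" if "M \<subseteq> C" "M \<subseteq> D" for M using that assms(1) by blast
  then have "{M \<in> \<L>0. M \<subseteq> C} \<inter> {M \<in> \<L>0. M \<subseteq> D} = {}" using trivial_nonempty by blast
  then have "closed_count C + closed_count D = card ({M \<in> \<L>0. M \<subseteq> C} \<union> {M \<in> \<L>0. M \<subseteq> D})"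
    unfolding closed_count_def using finite_trivial by (subst card_Un_disjoint) auto
  also have "\<dots> \<le> closed_count B"
    unfolding closed_count_def using finite_trivial assms by (intro card_mono) auto
  finally show ?thesis .
qed

text \<open>
  Components contribute independent factors, and each of them is two-edge connected or contains two disjoint
  leaf sets.
\<close>

lemma closed_bound:
  assumes "D \<subseteq> verts G" "boundary G D = {}"
  shows "norm (pinned_sum G T D i) \<le> root_dim ^ (2 * closed_count D) * leaf_bound D"
proof -
  have "finite D" using assms(1) by (rule finite_subset) simp
  then show ?thesis using assms
  proof (induction D rule: finite_psubset_induct)
    case (psubset D)
    show ?case
    proof (cases "D = {}")
      case True
      have "1 \<le> root_dim ^ (2 * closed_count {} + leaf_count {})" using root_dim_ge1 by simp
      then show ?thesis using True by (simp add: leaf_bound_def norm_prod_def power_add)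
    next
      case False
      then obtain r where "r \<in> D" by auto
      then obtain C where C: "piece_of G C D" "r \<in> C" using piece_exists psubset.hyps(1) by metis
      have CD: "C \<subseteq> D" "connected_set G C" "incident G C \<inter> incident G (D - C) = {}" "C \<union> (D - C) = D"
        using C by (auto simp: piece_of_def)
      have fin: "finite C" "finite (D - C)" using CD psubset.hyps(1) finite_subset by auto
      have bdC: "boundary G C = {}" "boundary G (D - C) = {}"
        using CD(3) CD(1) psubset.prems(2) by (auto simp: boundary_def incident_def)
      have CV: "C \<subseteq> verts G" using CD psubset.prems by auto
      have 1: "norm (pinned_sum G T C i) \<le> root_dim ^ (2 * closed_count C) * leaf_bound C"
      proof (cases "C \<in> \<L>0")
        case True
        then have "{C} \<subseteq> {Q \<in> \<L>0. Q \<subseteq> C}" by auto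
        then have "1 \<le> closed_count C" unfolding closed_count_def
          using finite_trivial card_mono[of "{Q \<in> \<L>0. Q \<subseteq> C}" "{C}"] by auto
        then have "root_dim\<^sup>2 * leaf_bound C \<le> root_dim ^ (2 * closed_count C) * leaf_bound C"
          using root_dim_ge1 leaf_bound_nonneg by (intro mult_right_mono power_increasing) auto
        with component_bound[OF CV CD(2), of i] show ?thesis by simp
      next
        case False
        then obtain M M' where "M \<in> \<L>" "M' \<in> \<L>" "M \<subseteq> C" "M' \<subseteq> C" "M \<inter> M' = {}"
          using component_cases[OF CV CD(2) bdC(1)] by auto
        then have "norm (pinned_sum G T C i) \<le> 1 * leaf_bound C"
          using component_bound_leaves[OF CV CD(2)] by auto
        also have "\<dots> \<le> root_dim ^ (2 * closed_count C) * leaf_bound C"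
          using root_dim_ge1 leaf_bound_nonneg by (intro mult_right_mono) auto
        finally show ?thesis .
      qed
      have 2: "norm (pinned_sum G T (D - C) i)
          \<le> root_dim ^ (2 * closed_count (D - C)) * leaf_bound (D - C)"
        using C CD psubset.prems bdC by (intro psubset.IH) auto
      have "norm (pinned_sum G T D i) = norm (pinned_sum G T C i) * norm (pinned_sum G T (D - C) i)"
        using pinned_sum_Un[OF fin _ CD(3), of T i] CD(4) by (simp add: norm_mult)
      also have "\<dots> \<le> (root_dim ^ (2 * closed_count C) * leaf_bound C)
          * (root_dim ^ (2 * closed_count (D - C)) * leaf_bound (D - C))"
        using root_dim_ge1 leaf_bound_nonneg by (intro mult_mono 1 2) auto
      also have "\<dots> = root_dim ^ (2 * (closed_count C + closed_count (D - C)))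
          * (leaf_bound C * leaf_bound (D - C))"
        by (simp add: power_add algebra_simps)
      also have "\<dots> \<le> root_dim ^ (2 * closed_count D) * leaf_bound D"
        using root_dim_ge1 leaf_bound_nonneg closed_count_add[of C
            "D - C" D] leaf_bound_Un[OF _ CD(3)] CD(1,4)
        by (intro mult_mono power_increasing) auto
      finally show ?thesis .
    qed
  qed
qed

lemma graph_sum_pinned_sum: "graph_sum G T = pinned_sum G T (verts G) i"
proof -
  have "incident G (verts G) = arcs G" by (auto simp: incident_def)
  then show ?thesis
    unfolding graph_sum_def pinned_sum_def sum_out_def entry_def
    by (auto intro!: sum.cong prod.cong simp: override_on_def)
qed

lemma graph_sum_bound:
  "norm (graph_sum G T) \<le> sqrt (real CARD('n)) ^ (2 * card \<L>0 + card \<L>) * (\<Prod>e\<in>arcs G. op_norm (T e))"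
proof -
  have "incident G (verts G) = arcs G" "boundary G (verts G) = {}"
    by (auto simp: incident_def boundary_def)
  then have "norm (graph_sum G T)
      \<le> root_dim ^ (2 * closed_count (verts G) + leaf_count (verts G)) * norm_prod (arcs G)"
    using closed_bound[of "verts G"]
    by (simp add: graph_sum_pinned_sum[of undefined] leaf_bound_def power_add mult.assoc)
  also have "\<dots> \<le> root_dim ^ (2 * card \<L>0 + card \<L>) * norm_prod (arcs G)"
    using root_dim_ge1 norm_prod_nonneg finite_trivial finite_leaves
    by (intro mult_right_mono power_increasing add_mono mult_left_mono) (auto
        simp: closed_count_def leaf_count_def intro!: card_mono)
  finally show ?thesis by (simp add: root_dim_def norm_prod_def)
qed

end

section \<open>Bridges and the classes they separate\<close>

lemma boundary_Int: "boundary G (A \<inter> B) \<subseteq> boundary G A \<union> boundary G B"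
  by (auto simp: boundary_def)

lemma boundary_Diff: "boundary G (A - B) \<subseteq> boundary G A \<union> boundary G B"
  by (auto simp: boundary_def)

definition bridges :: "('a, 'b) pre_digraph \<Rightarrow> 'b set" where
  "bridges G = {e. \<exists>A \<subseteq> verts G. boundary G A = {e}}"

text \<open>
  The vertex sets bounded by bridges only form a Boolean algebra. Its atoms turn out to be the vertex sets
  of the two-edge connected components.
\<close>

definition bridge_cut :: "('a, 'b) pre_digraph \<Rightarrow> 'a set \<Rightarrow> bool" where
  "bridge_cut G A \<longleftrightarrow> A \<subseteq> verts G \<and> boundary G A \<subseteq> bridges G"

definition bridge_class :: "('a, 'b) pre_digraph \<Rightarrow> 'a set \<Rightarrow> bool" where
  "bridge_class G Q \<longleftrightarrow> bridge_cut G Q \<and> Q \<noteq> {} \<and> (\<forall>A \<subseteq> Q. bridge_cut G A \<longrightarrow> A = {} \<or> A = Q)"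

lemma bridgeE:
  assumes "e \<in> bridges G"
  obtains Z where "Z \<subseteq> verts G" "boundary G Z = {e}"
  using assms unfolding bridges_def by blast

lemma bridge_cut_bridge: "bridge_cut G A \<Longrightarrow> e \<in> boundary G A \<Longrightarrow> e \<in> bridges G"
  unfolding bridge_cut_def by blast

lemma bridge_cut_Int: "bridge_cut G A \<Longrightarrow> bridge_cut G B \<Longrightarrow> bridge_cut G (A \<inter> B)"
  using boundary_Int[of G A B] by (auto simp: bridge_cut_def)

lemma bridge_cut_Diff: "bridge_cut G A \<Longrightarrow> bridge_cut G B \<Longrightarrow> bridge_cut G (A - B)"
  using boundary_Diff[of G A B] by (auto simp: bridge_cut_def)

lemma bridge_cutI: "A \<subseteq> verts G \<Longrightarrow> boundary G A = {e} \<Longrightarrow> bridge_cut G A"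
  by (auto simp: bridge_cut_def bridges_def)

lemma bridge_class_or_disjoint:
  assumes "bridge_class G Q" "bridge_cut G A"
  shows "Q \<subseteq> A \<or> Q \<inter> A = {}"
proof -
  have "bridge_cut G (Q \<inter> A)" using assms bridge_cut_Int by (auto simp: bridge_class_def)
  then have "Q \<inter> A = {} \<or> Q \<inter> A = Q" using assms(1) by (auto simp: bridge_class_def)
  then show ?thesis by auto
qed

lemma bridge_classes_eq:
  assumes "bridge_class G Q" "bridge_class G Q'" "Q \<inter> Q' \<noteq> {}"
  shows "Q = Q'"
  using bridge_class_or_disjoint[of G Q Q'] bridge_class_or_disjoint[of G Q' Q] assms
  by (auto simp: bridge_class_def)

lemma bridge_class_connected_set:
  assumes "bridge_class G Q"
  shows "connected_set G Q"
  unfolding connected_set_def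
proof (intro conjI allI impI notI)
  assume "Q = {}" then show False using assms by (auto simp: bridge_class_def)
next
  fix A assume A: "A \<subseteq> Q" "A \<noteq> {}" "A \<noteq> Q" "incident G A \<inter> incident G (Q - A) = {}"
  then have "boundary G A \<subseteq> boundary G Q" by (auto simp: boundary_def incident_def)
  then have "bridge_cut G A" using assms A by (auto simp: bridge_class_def bridge_cut_def)
  then show False using assms A by (auto simp: bridge_class_def)
qed

lemma connected_set_no_closed:
  assumes "connected_set G B" "A \<subseteq> B" "boundary G A = {}" "A \<noteq> {}"
  shows "A = B"
proof (rule ccontr)
  assume "A \<noteq> B"
  then obtain e where "e \<in> incident G A" "e \<in> incident G (B - A)"
    using connected_setE[OF assms(1)] assms by metis
  then show False using assms(2,3) by (auto simp: incident_def boundary_def)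
qed

text \<open>
  A separate part of \<open>M\<close> that avoids the one boundary edge would also be separate from the rest of \<open>B\<close>.
\<close>

lemma connected_set_one_edge_cut:
  assumes B: "connected_set G B" and M: "M \<subseteq> B" "boundary G M = {e}"
  shows "connected_set G M"
  unfolding connected_set_def
proof (intro conjI allI impI notI)
  assume "M = {}" then show False using M by (auto simp: boundary_def)
next
  fix A assume A: "A \<subseteq> M" "A \<noteq> {}" "A \<noteq> M" "incident G A \<inter> incident G (M - A) = {}"
  have "boundary G A \<union> boundary G (M - A) \<subseteq> boundary G M" "boundary G A \<inter> boundary G (M - A) = {}"
    using A by (auto simp: boundary_def incident_def)
  moreover have "X = {} \<or> Y = {}" if "X \<union> Y \<subseteq> {e}" "X \<inter> Y = {}" for X Y using that by auto
  ultimately have "boundary G A = {} \<or> boundary G (M - A) = {}" using M(2) by metis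
  then show False
  proof
    assume "boundary G A = {}"
    then have "A = B" using connected_set_no_closed[OF B, of A] A M by auto
    then show False using A M by auto
  next
    assume "boundary G (M - A) = {}"
    then have "M - A = B" using connected_set_no_closed[OF B, of "M - A"] A M by auto
    then show False using A M by auto
  qed
qed

lemma piece_of_verts_closed:
  assumes "wf_digraph G" "piece_of G C (verts G)"
  shows "boundary G C = {}"
proof -
  have "boundary G C \<subseteq> incident G C \<inter> incident G (verts G - C)"
    using wf_digraph.head_in_verts[OF assms(1)] wf_digraph.tail_in_verts[OF assms(1)]
    by (auto simp: boundary_def incident_def)
  then show ?thesis using assms(2) unfolding piece_of_def by blast
qed

context fin_digraph
begin

lemma bridge_class_exists:
  assumes "v \<in> verts G"
  obtains Q where "bridge_class G Q" "v \<in> Q"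
proof -
  define P where "P A \<longleftrightarrow> bridge_cut G A \<and> v \<in> A" for A
  have "boundary G (verts G) = {}" by (auto simp: boundary_def)
  then have "P (verts G)" using assms by (simp add: P_def bridge_cut_def)
  then obtain Q where Q: "P Q" and least: "\<And>A. P A \<Longrightarrow> card Q \<le> card A"
    using ex_has_least_nat[of P "verts G" card] by auto
  have fQ: "finite Q" using Q finite_subset[of Q "verts G"] by (auto simp: P_def bridge_cut_def)
  have small: "A = Q" if "P A" "A \<subseteq> Q" for A
    using least[OF that(1)] that(2) fQ card_seteq by blast
  have "bridge_class G Q"
    unfolding bridge_class_def
  proof (intro conjI allI impI)
    show "bridge_cut G Q" "Q \<noteq> {}" using Q by (auto simp: P_def)
    fix A assume A: "A \<subseteq> Q" "bridge_cut G A"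
    show "A = {} \<or> A = Q"
    proof (cases "v \<in> A")
      case True then show ?thesis using small[of A] A by (auto simp: P_def)
    next
      case False
      then have "P (Q - A)" using Q A bridge_cut_Diff by (auto simp: P_def)
      then show ?thesis using small[of "Q - A"] A by auto
    qed
  qed
  then show thesis using that Q by (auto simp: P_def)
qed

lemma finite_bridge_classes: "finite {Q. bridge_class G Q}"
  by (rule finite_subset[of _ "Pow (verts G)"]) (auto simp: bridge_class_def bridge_cut_def)

text \<open>
  A smallest set \<open>M \<subseteq> B\<close> with a single boundary edge \<open>e\<close> is a class. If it were split by a bridge \<open>g\<close>, then
  \<open>e\<close> would touch only one of the two sides of \<open>g\<close> within \<open>M\<close>, and the other side would be a smaller set
  with a single boundary edge.
\<close>

lemma leaf_bridge_class_within:
  assumes B: "B \<subseteq> verts G" "connected_set G B" "card (boundary G B) = 1"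
  obtains Q where "bridge_class G Q" "card (boundary G Q) = 1" "Q \<subseteq> B"
proof -
  define P where "P A \<longleftrightarrow> A \<subseteq> B \<and> card (boundary G A) = 1" for A
  have "P B" using B by (simp add: P_def)
  then obtain M where M: "P M" and least: "\<And>A. P A \<Longrightarrow> card M \<le> card A"
    using ex_has_least_nat[of P B card] by auto
  have MV: "M \<subseteq> B" "M \<subseteq> verts G" using M B by (auto simp: P_def)
  have fM: "finite M" by (rule finite_subset[OF MV(2)]) simp
  have small: "A = M" if "A \<subseteq> M" "boundary G A = {g}" for A g
  proof -
    have "P A" using that MV by (auto simp: P_def)
    then show ?thesis using least fM that card_seteq by blast
  qed
  obtain e where e: "boundary G M = {e}" using M by (auto simp: P_def card_1_singleton_iff)
  have Mc: "connected_set G M" using connected_set_one_edge_cut[OF B(2) MV(1) e] .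
  have "bridge_class G M"
    unfolding bridge_class_def
  proof (intro conjI allI impI)
    show "bridge_cut G M" using bridge_cutI[OF MV(2) e] .
    show "M \<noteq> {}" using Mc by (simp add: connected_set_def)
    fix A assume A: "A \<subseteq> M" "bridge_cut G A"
    show "A = {} \<or> A = M"
    proof (rule ccontr)
      assume n: "\<not> (A = {} \<or> A = M)"
      then obtain g where g: "g \<in> incident G A" "g \<in> incident G (M - A)"
        using connected_setE[OF Mc A(1)] n by blast
      then have gM: "g \<in> arcs G" "tail G g \<in> M" "head G g \<in> M" and "g \<in> boundary G A"
        using A by (auto simp: incident_def boundary_def)
      then obtain Z where Z: "Z \<subseteq> verts G" "boundary G Z = {g}"
        using bridgeE[OF bridge_cut_bridge[OF A(2)]] by metis
      have ge: "g \<noteq> e" using gM e by (auto simp: boundary_def)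
      have b1: "boundary G (Z \<inter> M) \<subseteq> {g, e}" "g \<in> boundary G (Z \<inter> M)"
        and b2: "boundary G (M - Z) \<subseteq> {g, e}" "g \<in> boundary G (M - Z)"
        using boundary_Int[of G Z M] boundary_Diff[of G M Z] Z(2) e gM by (auto simp: boundary_def)
      have "e \<notin> boundary G (Z \<inter> M) \<or> e \<notin> boundary G (M - Z)"
        using e ge Z(2) by (auto simp: boundary_def)
      then have "boundary G (Z \<inter> M) = {g} \<or> boundary G (M - Z) = {g}" using b1 b2 by blast
      then have "Z \<inter> M = M \<or> M - Z = M" using small[of "Z \<inter> M" g] small[of "M - Z" g] by auto
      then have "g \<in> boundary G M \<or> g \<in> boundary G M" using b1(2) b2(2) by metis
      then show False using e ge by auto
    qed
  qed
  then show thesis using that M by (auto simp: P_def)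
qed

text \<open>
  A bridge inside the component splits it into two connected sides with one boundary edge each, and each
  side contains a leaf class.
\<close>

lemma component_bridge_class_cases:
  assumes B: "B \<subseteq> verts G" "connected_set G B" "boundary G B = {}"
  shows "bridge_class G B
      \<or> (\<exists>M M'. bridge_class G M \<and> card (boundary G M) = 1 \<and> bridge_class G M' \<and> card (boundary G M') = 1 \<and>
      M \<subseteq> B \<and> M' \<subseteq> B \<and> M \<inter> M' = {})"
proof (cases "bridge_class G B")
  case False
  have Bc: "bridge_cut G B" using B by (simp add: bridge_cut_def)
  then obtain A where A: "A \<subseteq> B" "bridge_cut G A" "A \<noteq> {}" "A \<noteq> B"
    using False B(2) by (auto simp: bridge_class_def connected_set_def)
  then obtain g where g: "g \<in> incident G A" "g \<in> incident G (B - A)"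
    using connected_setE[OF B(2) A(1,3,4)] by blast
  then have gB: "g \<in> arcs G" "tail G g \<in> B" "head G g \<in> B" and "g \<in> boundary G A"
    using A by (auto simp: incident_def boundary_def)
  then obtain Z where Z: "Z \<subseteq> verts G" "boundary G Z = {g}" using bridgeE[OF bridge_cut_bridge[OF A(2)]]
    by metis
  have b: "boundary G (Z \<inter> B) = {g}" "boundary G (B - Z) = {g}"
    using boundary_Int[of G Z B] boundary_Diff[of G B Z] Z(2) B(3) gB by (auto simp: boundary_def)
  have c: "connected_set G (Z \<inter> B)" "connected_set G (B - Z)"
    using connected_set_one_edge_cut[OF B(2) _ b(1)] connected_set_one_edge_cut[OF B(2) _ b(2)] by auto
  obtain M where M: "bridge_class G M" "card (boundary G M) = 1" "M \<subseteq> Z \<inter> B"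
  proof -
    have "Z \<inter> B \<subseteq> verts G" "card (boundary G (Z \<inter> B)) = 1" using b(1) B(1) by auto
    from leaf_bridge_class_within[OF this(1) c(1) this(2)] show ?thesis using that by blast
  qed
  obtain M' where M': "bridge_class G M'" "card (boundary G M') = 1" "M' \<subseteq> B - Z"
  proof -
    have "B - Z \<subseteq> verts G" "card (boundary G (B - Z)) = 1" using b(2) B(1) by auto
    from leaf_bridge_class_within[OF this(1) c(2) this(2)] show ?thesis using that by blast
  qed
  show ?thesis using M M' by blast
qed simp

definition bridge_class_of :: "'a \<Rightarrow> 'a set" where
  "bridge_class_of v = (THE Q. bridge_class G Q \<and> v \<in> Q)"

lemma bridge_class_of:
  assumes "v \<in> verts G"
  shows "bridge_class G (bridge_class_of v)" "v \<in> bridge_class_of v"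
proof -
  obtain Q where Q: "bridge_class G Q" "v \<in> Q" using bridge_class_exists[OF assms] .
  have "bridge_class G (bridge_class_of v) \<and> v \<in> bridge_class_of v"
    unfolding bridge_class_of_def by (rule theI[of _ Q]) (use Q bridge_classes_eq in auto)
  then show "bridge_class G (bridge_class_of v)" "v \<in> bridge_class_of v" by auto
qed

lemma bridge_class_of_eq: "bridge_class G Q \<Longrightarrow> v \<in> Q \<Longrightarrow> bridge_class_of v = Q"
proof -
  assume Q: "bridge_class G Q" "v \<in> Q"
  then have "v \<in> verts G" by (auto simp: bridge_class_def bridge_cut_def)
  note a = bridge_class_of[OF this]
  have "bridge_class_of v \<inter> Q \<noteq> {}" using a(2) Q(2) by blast
  then show ?thesis by (rule bridge_classes_eq[OF a(1) Q(1)])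
qed

lemma bridge_arc: "e \<in> bridges G \<Longrightarrow> e \<in> arcs G"
  by (auto simp: bridges_def boundary_def)

lemma boundary_compl: "boundary G (verts G - A) = boundary G A"
  by (auto simp: boundary_def)

lemma boundary_bridge_class_bridge: "bridge_class G Q \<Longrightarrow> e \<in> boundary G Q \<Longrightarrow> e \<in> bridges G"
  unfolding bridge_class_def bridge_cut_def by blast

lemma bridge_iff:
  assumes "e \<in> arcs G"
  shows "e \<in> bridges G \<longleftrightarrow> bridge_class_of (tail G e) \<noteq> bridge_class_of (head G e)"
proof
  assume e: "e \<in> bridges G"
  then obtain Z where Z: "Z \<subseteq> verts G" "boundary G Z = {e}" by (auto simp: bridges_def)
  have "bridge_cut G Z" using bridge_cutI[OF Z] .
  moreover have "tail G e \<in> bridge_class_of (tail G e)" "head G e \<in> bridge_class_of (head G e)"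
    "bridge_class G (bridge_class_of (tail G e))" "bridge_class G (bridge_class_of (head G e))"
      using assms bridge_class_of by auto
  moreover have "(tail G e \<in> Z) \<noteq> (head G e \<in> Z)" using Z by (auto simp: boundary_def)
  ultimately show "bridge_class_of (tail G e) \<noteq> bridge_class_of (head G e)"
    using bridge_class_or_disjoint[of G "bridge_class_of (tail G e)" Z] by auto
next
  assume n: "bridge_class_of (tail G e) \<noteq> bridge_class_of (head G e)"
  have a: "bridge_class G (bridge_class_of (tail G e))" "tail G e \<in> bridge_class_of (tail G e)"
    using assms bridge_class_of by auto
  have "head G e \<notin> bridge_class_of (tail G e)" using n bridge_class_of_eq[OF a(1)] by metis
  then have "e \<in> boundary G (bridge_class_of (tail G e))" using assms a by (auto simp: boundary_def)
  then show "e \<in> bridges G" using a by (auto simp: bridge_class_def bridge_cut_def)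
qed

lemma boundary_bridge_class:
  assumes "bridge_class G Q"
  shows "boundary G Q = {e \<in> bridges G. Q = bridge_class_of (tail G e)
      \<or> Q = bridge_class_of (head G e)}"
proof (rule set_eqI)
  fix e
  show "e \<in> boundary G Q
      \<longleftrightarrow> e \<in> {e \<in> bridges G. Q = bridge_class_of (tail G e) \<or> Q = bridge_class_of (head G e)}"
  proof (cases "e \<in> arcs G")
    case True
    have mem: "v \<in> Q \<longleftrightarrow> bridge_class_of v = Q" if "v \<in> verts G" for v
      using bridge_class_of[OF that] bridge_class_of_eq[OF assms] by auto
    have "e \<in> boundary G Q \<longleftrightarrow> (bridge_class_of (tail G e) = Q) \<noteq> (bridge_class_of (head G e) = Q)"
      using True mem by (auto simp: boundary_def)
    then show ?thesis using bridge_iff[OF True] by auto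
  next
    case False then show ?thesis using bridge_arc by (auto simp: boundary_def)
  qed
qed

text \<open>
  Two bridges between the same classes cannot exist: the cut of the first one keeps both classes on their
  own sides, so the second one would cross it as well.
\<close>

lemma boundary_bridge_classes_unique:
  assumes Q: "bridge_class G Q" "bridge_class G Q'" "Q \<noteq> Q'"
    and e: "e \<in> boundary G Q" "outer_end G Q e \<in> Q'"
    and f: "f \<in> boundary G Q" "outer_end G Q f \<in> Q'"
  shows "e = f"
proof -
  have "e \<in> bridges G" using e Q by (auto simp: bridge_class_def bridge_cut_def)
  then obtain Z where Z: "Z \<subseteq> verts G" "boundary G Z = {e}" by (auto simp: bridges_def)
  have zc: "bridge_cut G Z" using bridge_cutI[OF Z] .
  have "(tail G e \<in> Z) \<noteq> (head G e \<in> Z)" using Z by (auto simp: boundary_def)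
  then have "f \<in> boundary G Z"
    using e f bridge_class_or_disjoint[OF Q(1) zc] bridge_class_or_disjoint[OF Q(2) zc]
    by (auto simp: boundary_def outer_end_def split: if_splits)
  then show ?thesis using Z by auto
qed

lemma connected_set_verts_iff:
  "connected_set G (verts G) \<longleftrightarrow> verts G \<noteq> {} \<and> (\<forall>A \<subseteq> verts G. A \<noteq> {} \<longrightarrow> A \<noteq> verts G \<longrightarrow> boundary G A \<noteq> {})"
proof -
  have "incident G A \<inter> incident G (verts G - A) = boundary G A" if "A \<subseteq> verts G" for A
    using that by (auto simp: boundary_def incident_def)
  then show ?thesis unfolding connected_set_def by auto
qed

end

section \<open>Identification of the forest of two-edge connected components\<close>

context wf_digraph
begin

lemma connected_iff_connected_set: "Digraph_Component.connected G \<longleftrightarrow> connected_set G (verts G)"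
proof
  assume c: "Digraph_Component.connected G"
  then have ne: "verts G \<noteq> {}"
    and r: "\<And>u v. u \<in> verts G \<Longrightarrow> v \<in> verts G \<Longrightarrow> (u, v) \<in> rtrancl_on (verts G) ((arcs_ends G)\<^sup>s)"
    by (auto simp: connected_conv)
  show "connected_set G (verts G)"
    unfolding connected_set_def
  proof (intro conjI ne allI impI notI)
    fix A assume A: "A \<subseteq> verts G" "A \<noteq> {}" "A \<noteq> verts G" "incident G A \<inter> incident G (verts G - A) = {}"
    then obtain u w where uw: "u \<in> A" "w \<in> verts G" "w \<notin> A" by auto
    have "(u, w) \<in> rtrancl_on (verts G) ((arcs_ends G)\<^sup>s)" using r uw A by auto
    then have "w \<in> A"
    proof (induction rule: rtrancl_on_induct)
      case base then show ?case using uw by simp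
    next
      case (step y z)
      then obtain e where "e \<in> arcs G" "{y, z} = {tail G e, head G e}"
        by (auto simp: arcs_ends_def arc_to_ends_def symcl_def)
      then show ?case using step A by (auto simp: incident_def doubleton_eq_iff)
    qed
    then show False using uw by simp
  qed
next
  assume c: "connected_set G (verts G)"
  show "Digraph_Component.connected G"
    unfolding connected_conv
  proof (intro conjI ballI)
    show "verts G \<noteq> {}" using c by (simp add: connected_set_def)
    fix u v assume uv: "u \<in> verts G" "v \<in> verts G"
    define R where "R = {w \<in> verts G. (u, w) \<in> rtrancl_on (verts G) ((arcs_ends G)\<^sup>s)}"
    have "R = verts G"
    proof (rule ccontr)
      assume "R \<noteq> verts G"
      moreover have "R \<subseteq> verts G" "u \<in> R" using uv by (auto simp: R_def)
      ultimately obtain e where e: "e \<in> incident G R" "e \<in> incident G (verts G - R)"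
        using c unfolding connected_set_def by blast
      then have ea: "e \<in> arcs G" by (simp add: incident_def)
      have "(tail G e, head G e) \<in> (arcs_ends G)\<^sup>s" "(head G e, tail G e) \<in> (arcs_ends G)\<^sup>s"
        using ea by (force simp: arcs_ends_def arc_to_ends_def symcl_def)+
      then obtain a b where ab: "a \<in> R" "b \<in> verts G" "b \<notin> R" "(a, b) \<in> (arcs_ends G)\<^sup>s"
        using e ea head_in_verts[OF ea] tail_in_verts[OF ea] unfolding incident_def by blast
      then have "b \<in> R" using rtrancl_on_into_rtrancl_on by (fastforce simp: R_def)
      then show False using ab by simp
    qed
    then show "(u, v) \<in> rtrancl_on (verts G) ((arcs_ends G)\<^sup>s)" using uv by (auto simp: R_def)
  qed
qed

end

lemma incident_induce:
  "A \<subseteq> Q \<Longrightarrow> incident (G \<restriction> Q) A \<inter> incident (G \<restriction> Q) (Q - A) = incident G A \<inter> incident G (Q - A)"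
  by (auto simp: incident_def)

lemma connected_set_induce: "connected_set (G \<restriction> Q) Q \<longleftrightarrow> connected_set G Q"
  unfolding connected_set_def using incident_induce by metis

lemma incident_subgraph: "subgraph H G \<Longrightarrow> incident H A = incident G A \<inter> arcs H"
  by (auto simp: incident_def subgraph_def compatible_def)

lemma connected_set_subgraph: "subgraph H G \<Longrightarrow> connected_set H B \<Longrightarrow> connected_set G B"
proof -
  assume H: "subgraph H G" "connected_set H B"
  have t: "incident H A \<subseteq> incident G A" for A unfolding incident_subgraph[OF H(1)] by blast
  show ?thesis
    unfolding connected_set_def
  proof (intro conjI allI impI)
    show "B \<noteq> {}" using H(2) by (simp add: connected_set_def)
    fix A assume A: "A \<subseteq> B" "A \<noteq> {}" "A \<noteq> B"
    obtain e where "e \<in> incident H A" "e \<in> incident H (B - A)" using connected_setE[OF H(2) A] .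
    then show "incident G A \<inter> incident G (B - A) \<noteq> {}" using t by blast
  qed
qed

lemma boundary_Int_verts: "subgraph H G \<Longrightarrow> boundary H (Z \<inter> verts H) = boundary G Z \<inter> arcs H"
  by (auto simp: boundary_def subgraph_def compatible_def wf_digraph.head_in_verts wf_digraph.tail_in_verts)

lemma subgraph_same_verts_eq:
  assumes "subgraph (G \<restriction> Q) H" "subgraph H G" "verts H = Q"
  shows "H = G \<restriction> Q"
proof -
  have "tail H = tail G" "head H = head G" using assms by (auto simp: subgraph_def compatible_def)
  moreover have "arcs H = arcs (G \<restriction> Q)"
    using assms
    by (auto simp: subgraph_def compatible_def wf_digraph.head_in_verts wf_digraph.tail_in_verts
      dest: wf_digraph.head_in_verts wf_digraph.tail_in_verts)
  ultimately show ?thesis using assms(3) by (auto simp: induce_subgraph_def)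
qed

context fin_digraph
begin

lemma subgraph_fin:
  assumes "subgraph H G"
  shows "fin_digraph H"
proof -
  have "wf_digraph H" "finite (verts H)" "finite (arcs H)"
    using assms finite_subset[OF _ finite_verts] finite_subset[OF _ finite_arcs]
    by (auto simp: subgraph_def)
  then show ?thesis by (simp add: fin_digraph_def fin_digraph_axioms_def)
qed

lemma subgraph_connected_iff: "subgraph H G \<Longrightarrow> Digraph_Component.connected H \<longleftrightarrow> connected_set H (verts H)"
  using wf_digraph.connected_iff_connected_set by (auto simp: subgraph_def)

lemma component_iff:
  "connected_component_of_graph G H \<longleftrightarrow> (\<exists>B \<subseteq> verts G. connected_set G B \<and> boundary G B = {} \<and> H = G \<restriction> B)"
proof
  assume "connected_component_of_graph G H"
  then have H: "subgraph H G" "Digraph_Component.connected H"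
    and max: "\<And>H'. subgraph H H' \<Longrightarrow> subgraph H' G \<Longrightarrow> Digraph_Component.connected H' \<Longrightarrow> H' = H"
    by (auto simp: connected_component_of_graph_def max_subgraph_def)
  have c: "connected_set G (verts H)" using connected_set_subgraph H subgraph_connected_iff by blast
  then obtain r where r: "r \<in> verts H" by (auto simp: connected_set_def)
  have HV: "verts H \<subseteq> verts G" using H by (auto simp: subgraph_def)
  obtain C where C: "piece_of G C (verts G)" "r \<in> C"
    using piece_exists[OF finite_verts subsetD[OF HV r]] .
  have Cc: "C \<subseteq> verts G" "connected_set G C" "boundary G C = {}"
    using C piece_of_verts_closed[OF wf_digraph] by (auto simp: piece_of_def)
  have "verts H \<subseteq> C" using connected_set_subset_piece[OF c HV, of C] C r by (auto simp: piece_of_def)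
  have sC: "subgraph (G \<restriction> C) G" using Cc by (intro subgraph_induce_subgraphI)
  have "subgraph H (G \<restriction> C)"
    using H(1) sC \<open>verts H \<subseteq> C\<close>
    by (auto simp: subgraph_def compatible_def wf_digraph.head_in_verts wf_digraph.tail_in_verts
       dest: wf_digraph.head_in_verts wf_digraph.tail_in_verts)
  moreover have "Digraph_Component.connected (G \<restriction> C)"
    using subgraph_connected_iff[OF sC] Cc connected_set_induce[of G C] by simp
  ultimately have "G \<restriction> C = H" using max sC by blast
  then show "\<exists>B \<subseteq> verts G. connected_set G B \<and> boundary G B = {} \<and> H = G \<restriction> B" using Cc by auto
next
  assume "\<exists>B \<subseteq> verts G. connected_set G B \<and> boundary G B = {} \<and> H = G \<restriction> B"
  then obtain B where B: "B \<subseteq> verts G" "connected_set G B" "boundary G B = {}" and H: "H = G \<restriction> B"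
    by auto
  have sB: "subgraph H G" unfolding H using B by (intro subgraph_induce_subgraphI)
  have cB: "Digraph_Component.connected H"
    using subgraph_connected_iff[OF sB] B connected_set_induce[of G B] by (simp add: H)
  have "H' = H" if H': "subgraph H H'" "subgraph H' G" "Digraph_Component.connected H'" for H'
  proof (rule subgraph_same_verts_eq[of G B H', folded H])
    show "subgraph H H'" "subgraph H' G" using H' by auto
    have c: "connected_set G (verts H')" using connected_set_subgraph H' subgraph_connected_iff by blast
    have "B \<subseteq> verts H'" using H'(1) by (auto simp: subgraph_def H)
    then show "verts H' = B" using connected_set_no_closed[OF c _ B(3)] B(2)
      by (auto simp: connected_set_def)
  qed
  then show "connected_component_of_graph G H"
    using sB cB by (auto simp: connected_component_of_graph_def max_subgraph_def)
qed

lemma cutting_edge_connected_iff: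
  assumes "connected_set G (verts G)"
  shows "cutting_edge_connected G e \<longleftrightarrow> e \<in> bridges G"
proof -
  have wfd: "fin_digraph (del_arc e)" by unfold_locales (auto simp: del_arc_def)
  then interpret D: fin_digraph "del_arc e" .
  have V: "verts (del_arc e) = verts G" by simp
  have boundary: "boundary (del_arc e) A = boundary G A - {e}" for A by (auto simp: boundary_def)
  have ne: "verts G \<noteq> {}" using assms by (simp add: connected_set_def)
  have Dc: "connected_set (del_arc e) (verts G) \<longleftrightarrow>
      (\<forall>A \<subseteq> verts G. A \<noteq> {} \<longrightarrow> A \<noteq> verts G \<longrightarrow> boundary G A - {e} \<noteq> {})"
    using D.connected_set_verts_iff ne unfolding V boundary by simp
  show ?thesis
  proof
    assume "cutting_edge_connected G e"
    then have "e \<in> arcs G" "\<not> connected_set (del_arc e) (verts G)"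
      using D.connected_iff_connected_set by (auto simp: cutting_edge_connected_def)
    then obtain A where A: "A \<subseteq> verts G" "A \<noteq> {}" "A \<noteq> verts G" "boundary G A - {e} = {}"
      unfolding Dc by blast
    moreover have "boundary G A \<noteq> {}" using assms A(1-3) unfolding connected_set_verts_iff by blast
    ultimately have "boundary G A = {e}" by blast
    then show "e \<in> bridges G" using A by (auto simp: bridges_def)
  next
    assume "e \<in> bridges G"
    then obtain A where A: "A \<subseteq> verts G" "boundary G A = {e}" by (auto simp: bridges_def)
    have ea: "e \<in> boundary G A" using A(2) by simp
    have "boundary G {} = {}" "boundary G (verts G) = {}" by (auto simp: boundary_def)
    then have An: "A \<noteq> {}" "A \<noteq> verts G" using ea by auto
    have ea': "e \<in> arcs G" using ea by (simp add: boundary_def)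
    have "\<not> connected_set (del_arc e) (verts G)"
      unfolding Dc using A An by blast
    then show "cutting_edge_connected G e"
      using D.connected_iff_connected_set ea' by (auto simp: cutting_edge_connected_def)
  qed
qed

lemma cutting_edge_iff: "cutting_edge G e \<longleftrightarrow> e \<in> bridges G"
proof
  assume "cutting_edge G e"
  then obtain B
    where B: "B \<subseteq> verts G" "connected_set G B" "boundary G B = {}" "cutting_edge_connected (G \<restriction> B) e"
    by (auto simp: cutting_edge_def component_iff)
  have s: "subgraph (G \<restriction> B) G" using B by (intro subgraph_induce_subgraphI)
  then interpret H: fin_digraph "G \<restriction> B" by (rule subgraph_fin)
  have "e \<in> bridges (G \<restriction> B)"
    using H.cutting_edge_connected_iff B connected_set_induce[of G B] by simp
  then obtain A where A: "A \<subseteq> B" "boundary (G \<restriction> B) A = {e}" by (auto simp: bridges_def)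
  have "boundary G A = boundary (G \<restriction> B) A" using A(1) B(3) by (auto simp: boundary_def)
  moreover have "A \<subseteq> verts G" using A B by blast
  ultimately show "e \<in> bridges G" using A(2) unfolding bridges_def by blast
next
  assume e: "e \<in> bridges G"
  then obtain Z where Z: "Z \<subseteq> verts G" "boundary G Z = {e}" by (auto simp: bridges_def)
  have ea: "e \<in> arcs G" using e by (rule bridge_arc)
  obtain B where B: "piece_of G B (verts G)" "tail G e \<in> B"
    using piece_exists[OF finite_verts tail_in_verts[OF ea]] .
  have Bc: "B \<subseteq> verts G" "connected_set G B" "boundary G B = {}"
    using B piece_of_verts_closed[OF wf_digraph] by (auto simp: piece_of_def)
  have hB: "head G e \<in> B" using Bc(3) B(2) ea by (auto simp: boundary_def)
  have s: "subgraph (G \<restriction> B) G" using Bc by (intro subgraph_induce_subgraphI)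
  then interpret H: fin_digraph "G \<restriction> B" by (rule subgraph_fin)
  have "boundary (G \<restriction> B) (Z \<inter> B) = {e}"
    using boundary_Int_verts[OF s, of Z] Z ea B(2) hB by auto
  then have "e \<in> bridges (G \<restriction> B)" by (auto simp: bridges_def)
  then have "cutting_edge_connected (G \<restriction> B) e"
    using H.cutting_edge_connected_iff Bc connected_set_induce[of G B] by simp
  then show "cutting_edge G e" using Bc component_iff by (auto simp: cutting_edge_def)
qed

lemma two_edge_connected_iff:
  "two_edge_connected G \<longleftrightarrow> connected_set G (verts G) \<and> bridges G = {}"
  using cutting_edge_connected_iff connected_iff_connected_set by (auto simp: two_edge_connected_def)

text \<open>
  Suppose that \<open>e\<close> is the only edge of the induced subgraph leaving \<open>A \<subseteq> Q\<close>. Every other edge leaving \<open>A\<close>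
  is a bridge at \<open>Q\<close> and has a far side disjoint from \<open>Q\<close>. Adding these far sides to \<open>A\<close> gives a set whose
  only boundary edge in the whole graph is \<open>e\<close>, so \<open>e\<close> is a bridge and \<open>A\<close> contradicts the minimality of \<open>Q\<close>.
\<close>

lemma bridge_class_two_edge_connected:
  assumes Q: "bridge_class G Q"
  shows "two_edge_connected (G \<restriction> Q)"
proof -
  have QV: "Q \<subseteq> verts G" using Q by (auto simp: bridge_class_def bridge_cut_def)
  have s: "subgraph (G \<restriction> Q) G" using QV by (intro subgraph_induce_subgraphI)
  then interpret H: fin_digraph "G \<restriction> Q" by (rule subgraph_fin)
  have "bridges (G \<restriction> Q) = {}"
  proof (rule ccontr)
    assume "bridges (G \<restriction> Q) \<noteq> {}"
    then obtain e A where A: "A \<subseteq> Q" "boundary (G \<restriction> Q) A = {e}" by (auto simp: bridges_def)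
    have "\<exists>Z. Z \<subseteq> verts G \<and> boundary G Z = {b} \<and> Z \<inter> Q = {}" if b: "b \<in> boundary G Q" for b
    proof -
      have "b \<in> bridges G" using b Q by (auto simp: bridge_class_def bridge_cut_def)
      then obtain Z where Z: "Z \<subseteq> verts G" "boundary G Z = {b}" by (auto simp: bridges_def)
      have "boundary G (verts G - Z) = {b}" using Z by (simp add: boundary_compl)
      moreover have "Q \<subseteq> Z \<or> Z \<inter> Q = {}" using bridge_class_or_disjoint[OF Q bridge_cutI[OF Z]] by blast
      moreover have "Q \<subseteq> Z \<Longrightarrow> (verts G - Z) \<inter> Q = {}" by blast
      ultimately show ?thesis using Z by (metis Diff_subset)
    qed
    then obtain Z
      where Z: "\<And>b. b \<in> boundary G Q \<Longrightarrow> Z b \<subseteq> verts G \<and> boundary G (Z b) = {b} \<and> Z b \<inter> Q = {}"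
      by metis
    define S where "S = boundary G Q \<inter> boundary G A"
    define P where "P = A \<union> (\<Union>b\<in>S. Z b)"
    have ZQ: "Z b \<inter> Q = {}" "boundary G (Z b) = {b}" "Z b \<subseteq> verts G" if "b \<in> S" for b
      using Z that by (auto simp: S_def)
    have eQ: "e \<in> arcs G" "tail G e \<in> Q" "head G e \<in> Q" "(tail G e \<in> A) \<noteq> (head G e \<in> A)"
      using A(2) by (auto simp: boundary_def)
    have "boundary G P = {e}"
    proof (intro equalityI subsetI)
      fix g assume "g \<in> {e}"
      then show "g \<in> boundary G P" using eQ ZQ(1) by (auto simp: boundary_def P_def)
    next
      fix g assume g: "g \<in> boundary G P"
      \<comment> \<open>The bridges in \<open>S\<close> start in \<open>A\<close> and end in their own far sides.\<close>
      have bS: "b \<notin> boundary G P" if b: "b \<in> S" for b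
      proof -
        have "(tail G b \<in> A \<or> head G b \<in> A)" "b \<in> boundary G Q" "b \<in> boundary G (Z b)"
          using b ZQ(2) by (auto simp: S_def boundary_def)
        moreover have "tail G b \<in> Z b \<or> head G b \<in> Z b" using calculation(3)
          by (auto simp: boundary_def)
        ultimately have "tail G b \<in> P \<and> head G b \<in> P"
          using b ZQ(1)[OF b] A(1) by (auto simp: P_def boundary_def)
        then show ?thesis by (auto simp: boundary_def)
      qed
      have "g \<in> boundary G A \<or> (\<exists>b\<in>S. g \<in> boundary G (Z b))" using g by (auto simp: boundary_def P_def)
      then have "g \<in> boundary G A" using bS g ZQ(2) by auto
      moreover have "g \<notin> boundary G Q" using calculation bS g by (auto simp: S_def)
      ultimately have "g \<in> boundary (G \<restriction> Q) A" using A(1) by (auto simp: boundary_def)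
      then show "g \<in> {e}" using A(2) by simp
    qed
    moreover have "P \<subseteq> verts G" using A(1) QV ZQ(3) by (auto simp: P_def)
    ultimately have eb: "e \<in> bridges G" by (auto simp: bridges_def)
    have "boundary G A \<subseteq> boundary G Q \<union> {e}" using A by (auto simp: boundary_def)
    then have "bridge_cut G A" using Q eb A(1) QV by (auto simp: bridge_class_def bridge_cut_def)
    then have "A = {} \<or> A = Q" using Q A(1) by (auto simp: bridge_class_def)
    then show False using eQ by auto
  qed
  then show ?thesis
    using H.two_edge_connected_iff bridge_class_connected_set[OF Q] connected_set_induce[of G Q] by simp
qed

text \<open>
  Otherwise the subgraph contains a bridge of \<open>G\<close>, whose cut also disconnects the subgraph.
\<close>

lemma two_edge_connected_in_bridge_class:
  assumes H: "subgraph H G" "two_edge_connected H" and Q: "bridge_class G Q" "Q \<inter> verts H \<noteq> {}"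
  shows "verts H \<subseteq> Q"
proof (rule ccontr)
  assume n: "\<not> verts H \<subseteq> Q"
  interpret H: fin_digraph H using H(1) by (rule subgraph_fin)
  have c: "connected_set H (verts H)" "bridges H = {}" using H.two_edge_connected_iff H(2) by auto
  have "boundary H (Q \<inter> verts H) \<noteq> {}" using c(1) Q(2) n unfolding H.connected_set_verts_iff by blast
  then obtain e where e: "e \<in> boundary G Q" "e \<in> arcs H" using boundary_Int_verts[OF H(1), of Q] by auto
  obtain Z where Z: "boundary G Z = {e}" using bridgeE[OF boundary_bridge_class_bridge[OF Q(1) e(1)]]
    by metis
  then have "boundary H (Z \<inter> verts H) = {e}" using boundary_Int_verts[OF H(1), of Z] e(2) by auto
  then have "e \<in> bridges H" by (auto simp: bridges_def)
  then show False using c(2) by simp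
qed

lemma two_edge_component_iff: "two_edge_component G C \<longleftrightarrow> (\<exists>Q. bridge_class G Q \<and> C = G \<restriction> Q)"
proof
  assume "two_edge_component G C"
  then have C: "subgraph C G" "two_edge_connected C"
    and max: "\<And>H'. subgraph C H' \<Longrightarrow> subgraph H' G \<Longrightarrow> two_edge_connected H' \<Longrightarrow> H' = C"
    by (auto simp: two_edge_component_def max_subgraph_def)
  interpret H: fin_digraph C using C(1) by (rule subgraph_fin)
  have "verts C \<noteq> {}" using H.two_edge_connected_iff C(2) by (auto simp: connected_set_def)
  then obtain r where r: "r \<in> verts C" "r \<in> verts G" using C(1) by (auto simp: subgraph_def)
  obtain Q where Q: "bridge_class G Q" "r \<in> Q" using bridge_class_exists[OF r(2)] .
  have CQ: "verts C \<subseteq> Q" using two_edge_connected_in_bridge_class[OF C Q(1)] Q r by auto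
  have s: "subgraph (G \<restriction> Q) G" using Q
    by (intro subgraph_induce_subgraphI) (auto simp: bridge_class_def bridge_cut_def)
  have "subgraph C (G \<restriction> Q)"
    using C(1) s CQ
    by (auto simp: subgraph_def compatible_def dest: wf_digraph.head_in_verts wf_digraph.tail_in_verts)
  then have "G \<restriction> Q = C" using max s bridge_class_two_edge_connected[OF Q(1)] by blast
  then show "\<exists>Q. bridge_class G Q \<and> C = G \<restriction> Q" using Q by auto
next
  assume "\<exists>Q. bridge_class G Q \<and> C = G \<restriction> Q"
  then obtain Q where Q: "bridge_class G Q" and C: "C = G \<restriction> Q" by auto
  have s: "subgraph C G" unfolding C using Q
    by (intro subgraph_induce_subgraphI) (auto simp: bridge_class_def bridge_cut_def)
  have "H' = C" if H': "subgraph C H'" "subgraph H' G" "two_edge_connected H'" for H'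
  proof (rule subgraph_same_verts_eq[of G Q H', folded C])
    show "subgraph C H'" "subgraph H' G" using H' by auto
    have "Q \<subseteq> verts H'" using H'(1) by (auto simp: subgraph_def C)
    moreover have "verts H' \<subseteq> Q"
      using two_edge_connected_in_bridge_class[OF H'(2,3) Q] calculation Q
      by (auto simp: bridge_class_def)
    ultimately show "verts H' = Q" by auto
  qed
  then show "two_edge_component G C"
    using s bridge_class_two_edge_connected[OF Q]
    by (auto simp: two_edge_component_def max_subgraph_def C)
qed

definition forest_graph ::
    "(('a, 'b) pre_digraph, ('a, 'b) pre_digraph \<times> ('a, 'b) pre_digraph) pre_digraph" where
  "forest_graph = with_proj (component_forest G)"

lemma induce_inj: "G \<restriction> Q = G \<restriction> Q' \<longleftrightarrow> Q = Q'"
  by (metis induce_subgraph_verts)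

lemma verts_forest: "verts forest_graph = (\<lambda>Q. G \<restriction> Q) ` {Q. bridge_class G Q}"
  by (auto simp: forest_graph_def component_forest_def two_edge_component_iff)

lemma arcs_forest:
  "(G \<restriction> Q, D) \<in> arcs forest_graph
      \<longleftrightarrow> bridge_class G Q \<and> (\<exists>e\<in>boundary G Q. D = G \<restriction> (bridge_class_of (outer_end G Q e)))"
proof
  assume "(G \<restriction> Q, D) \<in> arcs forest_graph"
  then obtain Q' e where Q: "bridge_class G Q" "bridge_class G Q'" "D = G \<restriction> Q'" "Q \<noteq> Q'"
    and e: "e \<in> bridges G"
    "tail G e \<in> Q \<and> head G e \<in> Q' \<or> tail G e \<in> Q' \<and> head G e \<in> Q"
    by (auto simp: forest_graph_def component_forest_def two_edge_component_iff cutting_edge_iff induce_inj)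
  have "Q \<inter> Q' = {}" using bridge_classes_eq Q by blast
  then have "e \<in> boundary G Q" "outer_end G Q e \<in> Q'" using e bridge_arc
    by (auto simp: boundary_def outer_end_def)
  then show "bridge_class G Q \<and> (\<exists>e\<in>boundary G Q. D = G \<restriction> (bridge_class_of (outer_end G Q e)))"
    using Q bridge_class_of_eq by metis
next
  assume "bridge_class G Q \<and> (\<exists>e\<in>boundary G Q. D = G \<restriction> (bridge_class_of (outer_end G Q e)))"
  then obtain e where Q: "bridge_class G Q"
    and e: "e \<in> boundary G Q" "D = G \<restriction> (bridge_class_of (outer_end G Q e))" by auto
  have b: "e \<in> bridges G" using e Q by (auto simp: bridge_class_def bridge_cut_def)
  have o: "outer_end G Q e \<in> verts G" using bridge_arc[OF b] by (auto simp: outer_end_def)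
  note a = bridge_class_of[OF o]
  have "bridge_class_of (outer_end G Q e) \<noteq> Q" using a(2) boundary_ends(2)[OF e(1)] by metis
  moreover have "tail G e \<in> Q \<and> head G e \<in> bridge_class_of (outer_end G Q e)
      \<or> tail G e \<in> bridge_class_of (outer_end G Q e) \<and> head G e \<in> Q"
    using e(1) a(2) by (auto simp: boundary_def outer_end_def split: if_splits)
  ultimately show "(G \<restriction> Q, D) \<in> arcs forest_graph"
    unfolding forest_graph_def component_forest_def using Q a(1) b e(2)
    by (auto simp: two_edge_component_iff cutting_edge_iff induce_inj)
qed

lemma arcs_forest_verts:
  "(C, D) \<in> arcs forest_graph \<Longrightarrow> C \<in> verts forest_graph \<and> D \<in> verts forest_graph \<and> C \<noteq> D"
  by (auto simp: forest_graph_def component_forest_def)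

lemma forest_proj: "tail forest_graph = fst" "head forest_graph = snd"
  by (simp_all add: forest_graph_def)

lemma arcs_forest_sym: "(C, D) \<in> arcs forest_graph \<Longrightarrow> (D, C) \<in> arcs forest_graph"
  by (auto simp: forest_graph_def component_forest_def)

lemma fin_forest: "fin_digraph forest_graph"
proof -
  have "finite (verts forest_graph)" using finite_bridge_classes by (simp add: verts_forest)
  moreover have "arcs forest_graph \<subseteq> verts forest_graph \<times> verts forest_graph"
    using arcs_forest_verts by auto
  ultimately have "finite (arcs forest_graph)" by (meson finite_SigmaI finite_subset)
  show ?thesis
  proof unfold_locales
    fix e assume "e \<in> arcs forest_graph"
    then show "tail forest_graph e \<in> verts forest_graph" "head forest_graph e \<in> verts forest_graph"
      using arcs_forest_verts[of "fst e" "snd e"] by (auto simp: forest_proj)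
  qed fact+
qed

lemma trivial_leaf_iff:
  "trivial_leaf forest_graph l \<longleftrightarrow> (\<exists>Q. bridge_class G Q \<and> boundary G Q = {} \<and> l = G \<restriction> Q)"
proof -
  interpret F: fin_digraph forest_graph by (rule fin_forest)
  have boundary_iff: "boundary forest_graph {G \<restriction> Q} = {} \<longleftrightarrow> boundary G Q = {}"
    if Q: "bridge_class G Q" for Q
  proof -
    have "boundary forest_graph {G \<restriction> Q} = {} \<longleftrightarrow> (\<forall>D. (G \<restriction> Q, D) \<notin> arcs forest_graph)"
    proof
      assume b: "boundary forest_graph {G \<restriction> Q} = {}"
      show "\<forall>D. (G \<restriction> Q, D) \<notin> arcs forest_graph"
      proof (intro allI notI)
        fix D assume "(G \<restriction> Q, D) \<in> arcs forest_graph"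
        moreover from this have "G \<restriction> Q \<noteq> D" using arcs_forest_verts by blast
        ultimately have "(G \<restriction> Q, D) \<in> boundary forest_graph {G \<restriction> Q}"
          by (simp add: boundary_def forest_proj)
        then show False using b by simp
      qed
    next
      assume n: "\<forall>D. (G \<restriction> Q, D) \<notin> arcs forest_graph"
      show "boundary forest_graph {G \<restriction> Q} = {}"
      proof (rule ccontr)
        assume "boundary forest_graph {G \<restriction> Q} \<noteq> {}"
        then obtain C D where "(C, D) \<in> arcs forest_graph" "C = G \<restriction> Q \<or> D = G \<restriction> Q"
          by (auto simp: boundary_def forest_proj)
        then show False using n arcs_forest_sym by blast
      qed
    qed
    also have "\<dots> \<longleftrightarrow> boundary G Q = {}" using Q by (auto simp: arcs_forest)
    finally show ?thesis .
  qed
  have "trivial_leaf forest_graph l \<longleftrightarrow> l \<in> verts forest_graph \<and> boundary forest_graph {l} = {}"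
  proof
    assume "trivial_leaf forest_graph l"
    then show "l \<in> verts forest_graph \<and> boundary forest_graph {l} = {}"
      by (auto simp: trivial_leaf_def F.component_iff)
  next
    assume l: "l \<in> verts forest_graph \<and> boundary forest_graph {l} = {}"
    have "connected_set forest_graph {l}" by (auto simp: connected_set_def)
    then have "connected_component_of_graph forest_graph (forest_graph \<restriction> {l})"
      using l F.component_iff by blast
    then show "trivial_leaf forest_graph l" by (auto simp: trivial_leaf_def)
  qed
  also have "\<dots> \<longleftrightarrow> (\<exists>Q. bridge_class G Q \<and> boundary G Q = {} \<and> l = G \<restriction> Q)"
    unfolding verts_forest using boundary_iff by auto
  finally show ?thesis .
qed

text \<open>
  The degree in the forest counts bridges, because distinct bridges at \<open>Q\<close> lead to distinct classes.
\<close>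

lemma out_degree_forest:
  assumes Q: "bridge_class G Q"
  shows "card (out_arcs forest_graph (G \<restriction> Q)) = card (boundary G Q)"
proof -
  define h where "h e = (G \<restriction> Q, G \<restriction> (bridge_class_of (outer_end G Q e)))" for e
  have "out_arcs forest_graph (G \<restriction> Q) = h ` boundary G Q"
    using Q by (auto simp: out_arcs_def forest_proj arcs_forest h_def)
  moreover have "inj_on h (boundary G Q)"
  proof (rule inj_onI)
    fix e f assume ef: "e \<in> boundary G Q" "f \<in> boundary G Q" "h e = h f"
    have oe: "outer_end G Q e \<in> verts G" "outer_end G Q f \<in> verts G"
      using ef by (auto simp: boundary_def outer_end_def)
    have eq: "bridge_class_of (outer_end G Q f) = bridge_class_of (outer_end G Q e)" using ef(3)
      by (simp add: h_def induce_inj)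
    have n: "Q \<noteq> bridge_class_of (outer_end G Q e)"
      using bridge_class_of(2)[OF oe(1)] boundary_ends(2)[OF ef(1)] by metis
    have f2: "outer_end G Q f \<in> bridge_class_of (outer_end G Q e)" using bridge_class_of(2)[OF oe(2)]
      by (simp only: eq)
    show "e = f"
      by (rule boundary_bridge_classes_unique[OF Q bridge_class_of(1)[OF oe(1)] n ef(1) bridge_class_of(2)[OF oe(1)] ef(2) f2])
  qed
  ultimately show ?thesis by (simp add: card_image)
qed

lemma nontrivial_leaf_iff:
  "nontrivial_leaf forest_graph l \<longleftrightarrow> (\<exists>Q. bridge_class G Q \<and> card (boundary G Q) = 1 \<and> l = G \<restriction> Q)"
proof -
  interpret F: fin_digraph forest_graph by (rule fin_forest)
  have od: "out_arcs (forest_graph \<restriction> B) l = out_arcs forest_graph l"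
    if "l \<in> B" "boundary forest_graph B = {}" for B
    using that by (auto simp: out_arcs_def boundary_def)
  show ?thesis
  proof
    assume "nontrivial_leaf forest_graph l"
    then obtain H
      where H: "connected_component_of_graph forest_graph H" "l \<in> verts H" "out_degree H l = 1"
      unfolding nontrivial_leaf_def by blast
    then obtain B where B: "B \<subseteq> verts forest_graph" "boundary forest_graph B = {}" "l \<in> B"
      "out_degree (forest_graph \<restriction> B) l = 1"
      using F.component_iff by auto
    then obtain Q where "bridge_class G Q" "l = G \<restriction> Q" by (auto simp: verts_forest)
    then show "\<exists>Q. bridge_class G Q \<and> card (boundary G Q) = 1 \<and> l = G \<restriction> Q"
      using B(4) od[OF B(3,2)] out_degree_forest by (auto simp: out_degree_def)
  next
    assume "\<exists>Q. bridge_class G Q \<and> card (boundary G Q) = 1 \<and> l = G \<restriction> Q"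
    then obtain Q where Q: "bridge_class G Q" "card (boundary G Q) = 1" "l = G \<restriction> Q" by auto
    then have l: "l \<in> verts forest_graph" by (auto simp: verts_forest)
    obtain B where B: "piece_of forest_graph B (verts forest_graph)" "l \<in> B"
      using piece_exists[OF F.finite_verts l] .
    have Bc: "B \<subseteq> verts forest_graph" "connected_set forest_graph B" "boundary forest_graph B = {}"
      using B piece_of_verts_closed[OF F.wf_digraph] by (auto simp: piece_of_def)
    have "card (out_arcs forest_graph l) = 1" using out_degree_forest Q by simp
    then have d: "out_degree (forest_graph \<restriction> B) l = 1" using od[OF B(2) Bc(3)]
      by (simp add: out_degree_def)
    obtain a where "a \<in> out_arcs forest_graph l"
      using \<open>card (out_arcs forest_graph l) = 1\<close> by (metis card_1_singletonE insertI1)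
    then have a: "(l, snd a) \<in> arcs forest_graph" by (auto simp: out_arcs_def forest_proj)
    then have "snd a \<noteq> l" "snd a \<in> B" using arcs_forest_verts[OF a] Bc(3) B(2)
      by (auto simp: boundary_def forest_proj)
    then have "B \<noteq> {l}" by auto
    then show "nontrivial_leaf forest_graph l"
      unfolding nontrivial_leaf_def using d B(2) Bc F.component_iff
      by (intro exI[of _ "forest_graph \<restriction> B"]) auto
  qed
qed

definition closed_bridge_classes :: "'a set set"
  where "closed_bridge_classes = {Q. bridge_class G Q \<and> boundary G Q = {}}"
definition leaf_bridge_classes :: "'a set set"
  where "leaf_bridge_classes = {Q. bridge_class G Q \<and> card (boundary G Q) = 1}"

lemma finite_leaf_bridge_classes: "finite closed_bridge_classes" "finite leaf_bridge_classes"
  using finite_bridge_classes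
  by (auto simp: closed_bridge_classes_def leaf_bridge_classes_def elim: finite_subset[rotated])

text \<open>
  Trivial leaves are the classes without boundary edges, leaves of non-trivial trees those with exactly
  one.
\<close>

lemma graph_exponent_eq:
  "graph_exponent G = real (card closed_bridge_classes) + real (card leaf_bridge_classes) / 2"
proof -
  have inj: "inj_on (\<lambda>Q. G \<restriction> Q) X" for X by (auto simp: inj_on_def induce_inj)
  have L: "{l. trivial_leaf forest_graph l \<or> nontrivial_leaf forest_graph l}
      = (\<lambda>Q. G \<restriction> Q) ` (closed_bridge_classes \<union> leaf_bridge_classes)"
    by (auto simp: trivial_leaf_iff nontrivial_leaf_iff closed_bridge_classes_def leaf_bridge_classes_def)
  have d: "closed_bridge_classes \<inter> leaf_bridge_classes = {}"
    by (auto simp: closed_bridge_classes_def leaf_bridge_classes_def)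
  have "graph_exponent G
      = (\<Sum>Q\<in>closed_bridge_classes \<union> leaf_bridge_classes. leaf_weight forest_graph (G \<restriction> Q))"
    unfolding graph_exponent_def Let_def forest_graph_def[symmetric] L
    by (subst sum.reindex[OF inj]) simp
  also have "\<dots> = (\<Sum>Q\<in>closed_bridge_classes. leaf_weight forest_graph (G \<restriction> Q))
      + (\<Sum>Q\<in>leaf_bridge_classes. leaf_weight forest_graph (G \<restriction> Q))"
    using finite_leaf_bridge_classes d by (rule sum.union_disjoint)
  also have "(\<Sum>Q\<in>closed_bridge_classes. leaf_weight forest_graph (G \<restriction> Q))
      = (\<Sum>Q\<in>closed_bridge_classes. 1)"
    by (rule sum.cong) (auto simp: leaf_weight_def trivial_leaf_iff closed_bridge_classes_def)
  also have "(\<Sum>Q\<in>leaf_bridge_classes. leaf_weight forest_graph (G \<restriction> Q))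
      = (\<Sum>Q\<in>leaf_bridge_classes. 1 / 2)"
    by (rule sum.cong) (auto simp: leaf_weight_def trivial_leaf_iff leaf_bridge_classes_def induce_inj)
  finally show ?thesis by simp
qed

end

section \<open>Matrices attaining the bound\<close>

context fin_digraph
begin

text \<open>
  A unit vector \<open>u\<close> for each class: the normalized vector of ones for a leaf of a non-trivial tree, a basis
  vector otherwise. The choice makes \<open>\<Sum>\<^sub>k u k ^ d\<close>, with \<open>d\<close> the number of bridges at the class, equal to
  \<open>\<surd>N\<close> for \<open>d = 1\<close>, to \<open>1\<close> for \<open>d \<ge> 2\<close> and to \<open>N\<close> for \<open>d = 0\<close>.
\<close>

definition leaf_vec :: "'a set \<Rightarrow> 'n::finite \<Rightarrow> real" where
  "leaf_vec Q k = (if card (boundary G Q) = 1 then 1 / sqrt (real CARD('n))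
     else if k = undefined then 1 else 0)"

lemma leaf_vec_unit: "(\<Sum>k\<in>UNIV. (leaf_vec Q (k :: 'n::finite))\<^sup>2) = 1"
proof (cases "card (boundary G Q) = 1")
  case True then show ?thesis by (simp add: leaf_vec_def power_divide)
next
  case False
  then have "(\<Sum>k\<in>UNIV. (leaf_vec Q (k :: 'n::finite))\<^sup>2)
      = (\<Sum>k\<in>(UNIV::'n set). if k = undefined then 1 else 0)"
    by (intro sum.cong) (auto simp: leaf_vec_def)
  then show ?thesis by simp
qed

definition leaf_exp :: "'a set \<Rightarrow> nat" where
  "leaf_exp Q = (if boundary G Q = {} then 2 else if card (boundary G Q) = 1 then 1 else 0)"

lemma leaf_vec_power_sum:
  "(\<Sum>k\<in>UNIV. leaf_vec Q (k :: 'n::finite) ^ card (boundary G Q)) = sqrt (real CARD('n)) ^ leaf_exp Q"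
proof -
  consider "boundary G Q = {}" | "card (boundary G Q) = 1" | "boundary G Q \<noteq> {}"
      "card (boundary G Q) \<noteq> 1" by blast
  then show ?thesis
  proof cases
    case 1 then show ?thesis by (simp add: leaf_exp_def)
  next
    case 2
    then have "boundary G Q \<noteq> {}" by auto
    then show ?thesis using 2 by (simp add: leaf_exp_def leaf_vec_def real_div_sqrt)
  next
    case 3
    then have "card (boundary G Q) \<noteq> 0" by simp
    then have "(\<Sum>k\<in>UNIV. leaf_vec Q (k :: 'n::finite) ^ card (boundary G Q))
        = (\<Sum>k\<in>(UNIV::'n set). if k = undefined then 1 else 0)"
      using 3 by (intro sum.cong) (auto simp: leaf_vec_def)
    then show ?thesis using 3 by (simp add: leaf_exp_def)
  qed
qed

text \<open>
  Identity matrices away from the bridges force a constant index on each class; the rank one matrices on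
  the bridges then decouple the classes.
\<close>

definition extremal :: "'b \<Rightarrow> complex^'n^'n" where
  "extremal e = (if e \<in> bridges G
     then (\<chi> a b. of_real (leaf_vec (bridge_class_of (head G e)) a * leaf_vec (bridge_class_of (tail G e)) b))
     else mat 1)"

end

lemma op_norm_mat_1: "op_norm (mat 1 :: complex^'n^'n) = 1"
  unfolding op_norm_def matrix_vector_mul_lid by (rule onorm_id)

lemma op_norm_outer_product:
  fixes u w :: "'n::finite \<Rightarrow> real"
  assumes u: "(\<Sum>k\<in>UNIV. (u k)\<^sup>2) = 1" and w: "(\<Sum>k\<in>UNIV. (w k)\<^sup>2) = 1"
  shows "op_norm ((\<chi> a b. of_real (u a * w b)) :: complex^'n^'n) = 1"
proof -
  define M :: "complex^'n^'n" where "M = (\<chi> a b. of_real (u a * w b))"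
  have Mx: "(norm (M *v x))\<^sup>2 = (norm (\<Sum>b\<in>UNIV. of_real (w b) * x $ b))\<^sup>2" for x
  proof -
    have "(M *v x) $ a = of_real (u a) * (\<Sum>b\<in>UNIV. of_real (w b) * x $ b)" for a
      by (simp add: M_def matrix_vector_mult_def sum_distrib_left mult.assoc)
    then have "(norm (M *v x))\<^sup>2 = (\<Sum>a\<in>UNIV. (u a)\<^sup>2 * (norm (\<Sum>b\<in>UNIV. of_real (w b) * x $ b))\<^sup>2)"
      by (simp add: norm_vec_sq norm_mult power_mult_distrib)
    then show ?thesis by (simp add: u flip: sum_distrib_right)
  qed
  have le: "norm (M *v x) \<le> 1 * norm x" for x
  proof -
    have "norm (\<Sum>b\<in>UNIV. of_real (w b) * x $ b) \<le> (\<Sum>b\<in>UNIV. \<bar>w b\<bar> * norm (x $ b))"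
      by (rule order_trans[OF norm_sum]) (simp add: norm_mult)
    then have "(norm (\<Sum>b\<in>UNIV. of_real (w b) * x $ b))\<^sup>2 \<le> (\<Sum>b\<in>UNIV. \<bar>w b\<bar> * norm (x $ b))\<^sup>2"
      by (intro power_mono) auto
    also have "\<dots> \<le> (\<Sum>b\<in>UNIV. \<bar>w b\<bar>\<^sup>2) * (\<Sum>b\<in>UNIV. (norm (x $ b))\<^sup>2)"
      by (rule Cauchy_Schwarz_ineq_sum)
    finally have "(norm (M *v x))\<^sup>2 \<le> (norm x)\<^sup>2"
      by (simp add: Mx w norm_vec_sq[of x])
    then show ?thesis using power2_le_imp_le by fastforce
  qed
  define y :: "complex^'n" where "y = (\<chi> b. of_real (w b))"
  have ny: "norm y = 1"
  proof -
    have "(norm y)\<^sup>2 = 1" by (simp add: norm_vec_sq y_def w)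
    then show ?thesis
      by (simp add: power2_eq_1_iff) (metis norm_ge_zero not_one_le_zero neg_0_le_iff_le)
  qed
  have "(\<Sum>b\<in>UNIV. of_real (w b) * y $ b) = complex_of_real (\<Sum>b\<in>UNIV. (w b)\<^sup>2)"
    by (simp add: y_def power2_eq_square)
  then have "(norm (M *v y))\<^sup>2 = 1" by (simp only: Mx w) simp
  then have nM: "norm (M *v y) = 1"
    by (simp add: power2_eq_1_iff) (metis norm_ge_zero not_one_le_zero neg_0_le_iff_le)
  have "norm (M *v y) \<le> onorm (\<lambda>x. M *v x) * norm y"
    by (rule onorm) (rule matrix_vector_mul_bounded_linear)
  then have "1 \<le> op_norm M" by (simp add: nM ny op_norm_def)
  moreover have "op_norm M \<le> 1"
    unfolding op_norm_def using le by (intro onorm_le) simp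
  ultimately show ?thesis by (simp add: M_def)
qed

context fin_digraph
begin

lemma op_norm_extremal: "op_norm (extremal e :: complex^'n^'n) = 1"
  unfolding extremal_def
  by (cases "e \<in> bridges G")
    (simp_all only: if_True if_False op_norm_outer_product[OF leaf_vec_unit leaf_vec_unit] op_norm_mat_1)

text \<open>
  The vertices of \<open>Q\<close> with the same index as \<open>v\<close> form a set bounded by bridges.
\<close>

lemma extremal_bridge_class_eq:
  assumes i: "\<And>e. e \<in> arcs G \<Longrightarrow> e \<notin> bridges G \<Longrightarrow> i (head G e) = i (tail G e)"
    and Q: "bridge_class G Q" "v \<in> Q" "w \<in> Q"
  shows "i v = i w"
proof -
  define A where "A = {x \<in> Q. i x = i v}"
  have "boundary G A \<subseteq> bridges G"
  proof
    fix e assume e: "e \<in> boundary G A"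
    show "e \<in> bridges G"
    proof (cases "e \<in> boundary G Q")
      case True then show ?thesis using boundary_bridge_class_bridge Q by blast
    next
      case False
      then have "i (head G e) \<noteq> i (tail G e)" "e \<in> arcs G" using e by (auto simp: boundary_def A_def)
      then show ?thesis using i by blast
    qed
  qed
  then have "bridge_cut G A" using Q by (auto simp: bridge_cut_def bridge_class_def A_def)
  moreover have "A \<subseteq> Q" "A \<noteq> {}" using Q by (auto simp: A_def)
  ultimately have "A = Q" using Q by (auto simp: bridge_class_def)
  with Q(3) have "w \<in> A" by simp
  then show ?thesis by (simp add: A_def)
qed

text \<open>
  Only assignments that are constant on classes contribute; they correspond to functions \<open>g\<close> on the set of
  classes. Collecting the vector entries on the bridges by classes turns the summand into a product over
  classes, and the sum of products into a product of sums.
\<close>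

lemma extremal_sum:
  "graph_sum G (extremal :: 'b \<Rightarrow> complex^'n^'n)
      = of_real (sqrt (real CARD('n)) ^ (\<Sum>Q | bridge_class G Q. leaf_exp Q))"
proof -
  define At where "At = {Q. bridge_class G Q}"
  define P where "P = (\<lambda>i :: 'a \<Rightarrow> 'n. \<Prod>e\<in>arcs G. extremal e $ i (head G e) $ i (tail G e) :: complex)"
  define emb where "emb = (\<lambda>g :: 'a set \<Rightarrow> 'n. restrict (\<lambda>v. g (bridge_class_of v)) (verts G))"
  have fAt: "finite At" unfolding At_def by (rule finite_bridge_classes)
  have aAt: "bridge_class_of v \<in> At" if "v \<in> verts G" for v using bridge_class_of[OF that]
    by (simp add: At_def)
  have emb_mem: "emb g \<in> verts G \<rightarrow>\<^sub>E UNIV" for g by (simp add: emb_def)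
  have inj: "inj_on emb (At \<rightarrow>\<^sub>E UNIV)"
  proof (rule inj_onI)
    fix g h assume gh: "g \<in> At \<rightarrow>\<^sub>E UNIV" "h \<in> At \<rightarrow>\<^sub>E UNIV" "emb g = emb h"
    show "g = h"
    proof (rule PiE_ext[OF gh(1,2)])
      fix Q assume "Q \<in> At"
      then have Q: "bridge_class G Q" "Q \<noteq> {}" "Q \<subseteq> verts G"
        by (auto simp: At_def bridge_class_def bridge_cut_def)
      then obtain v where v: "v \<in> Q" "v \<in> verts G" by blast
      have "emb g v = emb h v" using gh(3) by simp
      then show "g Q = h Q" using v bridge_class_of_eq[OF Q(1) v(1)] by (simp add: emb_def)
    qed
  qed
  \<comment> \<open>An edge that is not a bridge carries the identity matrix, so it kills every other assignment.\<close>
  have zero: "P i = 0" if i: "i \<in> verts G \<rightarrow>\<^sub>E UNIV" "i \<notin> emb ` (At \<rightarrow>\<^sub>E UNIV)" for i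
  proof (rule ccontr)
    assume P0: "P i \<noteq> 0"
    have const: "i (head G e) = i (tail G e)" if e: "e \<in> arcs G" "e \<notin> bridges G" for e
    proof (rule ccontr)
      assume "i (head G e) \<noteq> i (tail G e)"
      then have "extremal e $ i (head G e) $ i (tail G e) = (0 :: complex)"
        using e by (simp add: extremal_def mat_def)
      then have "P i = 0" unfolding P_def using e(1) by (intro prod_zero) auto
      then show False using P0 by simp
    qed
    \<comment> \<open>Read off the constant value on a class at any of its vertices.\<close>
    define g where "g = restrict (\<lambda>Q. i (SOME v. v \<in> Q)) At"
    have "i = emb g"
    proof (rule PiE_ext[OF i(1) emb_mem])
      fix v assume v: "v \<in> verts G"
      have "(SOME w. w \<in> bridge_class_of v) \<in> bridge_class_of v" using bridge_class_of(2)[OF v]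
        by (rule someI)
      then have "i v = i (SOME w. w \<in> bridge_class_of v)"
        using extremal_bridge_class_eq[of i "bridge_class_of v"] const bridge_class_of[OF v] by blast
      then show "i v = emb g v" using v aAt[OF v] by (simp add: emb_def g_def)
    qed
    moreover have "g \<in> At \<rightarrow>\<^sub>E UNIV" by (simp add: g_def)
    ultimately show False using i(2) by blast
  qed
  have Pemb: "P (emb g) = of_real (\<Prod>Q\<in>At. leaf_vec Q (g Q) ^ card (boundary G Q))" for g
  proof -
    have br: "bridges G \<subseteq> arcs G" using bridge_arc by blast
    then have fb: "finite (bridges G)" by (rule finite_subset) simp
    define c where "c e = leaf_vec (bridge_class_of (head G e)) (g (bridge_class_of (head G e))) *
        leaf_vec (bridge_class_of (tail G e)) (g (bridge_class_of (tail G e)))" for e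
    have "P (emb g) = (\<Prod>e\<in>arcs G. if e \<in> bridges G then of_real (c e) else 1)"
      unfolding P_def
    proof (rule prod.cong[OF refl])
      fix e assume e: "e \<in> arcs G"
      then have v: "head G e \<in> verts G" "tail G e \<in> verts G" by auto
      show "extremal e $ emb g (head G e) $ emb g (tail G e)
          = (if e \<in> bridges G then of_real (c e) else 1)"
        using bridge_iff[OF e] v by (simp add: extremal_def emb_def c_def mat_def)
    qed
    also have "\<dots> = of_real (\<Prod>e\<in>bridges G. c e)"
      using br by (simp add: prod.If_cases Int_absorb1)
    also have "(\<Prod>e\<in>bridges G. c e)
        = (\<Prod>e\<in>bridges G. \<Prod>Q\<in>At. if e \<in> boundary G Q then leaf_vec Q (g Q) else 1)"
    proof (rule prod.cong[OF refl])
      fix e assume e: "e \<in> bridges G"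
      then have ea: "e \<in> arcs G" by (rule bridge_arc)
      then have v: "head G e \<in> verts G" "tail G e \<in> verts G" by auto
      have ne: "bridge_class_of (tail G e) \<noteq> bridge_class_of (head G e)" using bridge_iff[OF ea] e
        by simp
      have "{Q \<in> At. e \<in> boundary G Q} = {bridge_class_of (head G e), bridge_class_of (tail G e)}"
        using e aAt v by (auto simp: At_def boundary_bridge_class)
      then have "(\<Prod>Q\<in>At. if e \<in> boundary G Q then leaf_vec Q (g Q) else 1)
          = (\<Prod>Q\<in>{bridge_class_of (head G e), bridge_class_of (tail G e)}. leaf_vec Q (g Q))"
        using prod.inter_filter[OF fAt, of "\<lambda>Q. leaf_vec Q (g Q)" "\<lambda>Q. e \<in> boundary G Q"] by simp
      then show "c e = (\<Prod>Q\<in>At. if e \<in> boundary G Q then leaf_vec Q (g Q) else 1)"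
        using ne by (simp add: c_def)
    qed
    also have "\<dots> = (\<Prod>Q\<in>At. \<Prod>e\<in>bridges G. if e \<in> boundary G Q then leaf_vec Q (g Q) else 1)"
      by (rule prod.swap)
    also have "\<dots> = (\<Prod>Q\<in>At. leaf_vec Q (g Q) ^ card (boundary G Q))"
    proof (rule prod.cong[OF refl])
      fix Q assume "Q \<in> At"
      then have "{e \<in> bridges G. e \<in> boundary G Q} = boundary G Q" using boundary_bridge_class_bridge
        by (auto simp: At_def)
      then show "(\<Prod>e\<in>bridges G. if e \<in> boundary G Q then leaf_vec Q (g Q) else 1)
          = leaf_vec Q (g Q) ^ card (boundary G Q)"
        using fb by (simp flip: prod.inter_filter)
    qed
    finally show ?thesis .
  qed
  have fin: "finite (verts G \<rightarrow>\<^sub>E (UNIV :: 'n set))" by (intro finite_PiE) auto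
  have "graph_sum G (extremal :: 'b \<Rightarrow> complex^'n^'n) = (\<Sum>i\<in>verts G \<rightarrow>\<^sub>E UNIV. P i)"
    by (simp add: graph_sum_def P_def)
  also have "\<dots> = (\<Sum>i\<in>emb ` (At \<rightarrow>\<^sub>E UNIV). P i)"
    using emb_mem zero by (intro sum.mono_neutral_right[OF fin]) auto
  also have "\<dots> = (\<Sum>g\<in>At \<rightarrow>\<^sub>E (UNIV :: 'n set). of_real (\<Prod>Q\<in>At. leaf_vec Q (g Q) ^ card (boundary G Q)))"
    by (simp add: sum.reindex[OF inj] Pemb)
  also have "\<dots> = of_real (\<Prod>Q\<in>At. \<Sum>k\<in>(UNIV :: 'n set). leaf_vec Q k ^ card (boundary G Q))"
    using fAt by (subst prod_sum_PiE) auto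
  also have "\<dots> = of_real (sqrt (real CARD('n)) ^ (\<Sum>Q\<in>At. leaf_exp Q))"
    by (simp add: leaf_vec_power_sum power_sum)
  finally show ?thesis by (simp add: At_def)
qed

lemma sum_leaf_exp:
  "(\<Sum>Q | bridge_class G Q. leaf_exp Q) = 2 * card closed_bridge_classes + card leaf_bridge_classes"
proof -
  have "(\<Sum>Q | bridge_class G Q. leaf_exp Q)
      = (\<Sum>Q | bridge_class G Q. (if boundary G Q = {} then 2 else 0) + (if card (boundary G Q) = 1 then 1 else 0))"
    by (rule sum.cong) (auto simp: leaf_exp_def)
  also have "\<dots> = (\<Sum>Q\<in>closed_bridge_classes. 2) + (\<Sum>Q\<in>leaf_bridge_classes. 1)"
    using finite_bridge_classes
    by (simp add: sum.distrib sum.inter_filter[symmetric] closed_bridge_classes_def leaf_bridge_classes_def)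
  finally show ?thesis by simp
qed

lemma powr_graph_exponent:
  "real CARD('n::finite) powr graph_exponent G
      = sqrt (real CARD('n)) ^ (2 * card closed_bridge_classes + card leaf_bridge_classes)"
proof -
  have "sqrt (real CARD('n)) ^ k = real CARD('n) powr (real k / 2)" for k
    by (simp add: powr_half_sqrt[symmetric] powr_powr flip: powr_realpow)
  then show ?thesis by (simp add: graph_exponent_eq add_divide_distrib)
qed

lemma graph_sum_upper:
  fixes T :: "'b \<Rightarrow> complex^'n^'n"
  shows "norm (graph_sum G T) \<le> real CARD('n) powr graph_exponent G * (\<Prod>e\<in>arcs G. op_norm (T e))"
proof -
  interpret exhaustive_leaf_family G T leaf_bridge_classes closed_bridge_classes
  proof unfold_locales
    show "finite leaf_bridge_classes" "finite closed_bridge_classes"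
      by (rule finite_leaf_bridge_classes)+
    show "connected_set G M" if "M \<in> leaf_bridge_classes" for M using that bridge_class_connected_set
      by (auto simp: leaf_bridge_classes_def)
    show "\<exists>M\<in>leaf_bridge_classes. M \<subseteq> B"
      if "B \<subseteq> verts G" "connected_set G B" "card (boundary G B) = 1" for B
      using leaf_bridge_class_within[OF that] by (auto simp: leaf_bridge_classes_def)
    show "{} \<notin> closed_bridge_classes" by (auto simp: closed_bridge_classes_def bridge_class_def)
    show "B \<in> closed_bridge_classes
        \<or> (\<exists>M\<in>leaf_bridge_classes. \<exists>M'\<in>leaf_bridge_classes. M \<subseteq> B \<and> M' \<subseteq> B \<and> M \<inter> M' = {})"
      if "B \<subseteq> verts G" "connected_set G B" "boundary G B = {}" for B
      using component_bridge_class_cases[OF that] that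
      unfolding closed_bridge_classes_def leaf_bridge_classes_def by blast
  qed
  show ?thesis using graph_sum_bound by (simp only: powr_graph_exponent)
qed

end

theorem theorem6:
  fixes G :: "('a, 'b) pre_digraph"
  assumes "fin_digraph G"
  shows "(\<forall>T :: 'b \<Rightarrow> complex^'n^'n.
            norm (graph_sum G T)
              \<le> real CARD('n) powr graph_exponent G * (\<Prod>e\<in>arcs G. op_norm (T e))) \<and>
         (\<exists>T :: 'b \<Rightarrow> complex^'n^'n.
            (\<forall>e\<in>arcs G. op_norm (T e) = 1) \<and>
            graph_sum G T = of_real (real CARD('n) powr graph_exponent G))"
proof -
  interpret fin_digraph G by fact
  show ?thesis
    using graph_sum_upper op_norm_extremal
    by (auto intro!: exI[of _ extremal] simp: extremal_sum sum_leaf_exp powr_graph_exponent)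
qed

end
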